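(* Let $\mathcal{T}$ be a triangulated category, and let $u\colon X\to Y$, $u'\colon X'\to Y'$, $f\colon X\to X'$, $g\colon Y\to Y'$ be maps in $\mathcal{T}$ with $gu=u'f$. Choose exact triangles $X\xrightarrow{u}Y\xrightarrow{v}Z\xrightarrow{w}\Sigma X$ and $X'\xrightarrow{u'}Y'\xrightarrow{v'}Z'\xrightarrow{w'}\Sigma X'$. Then a lift $k\colon Y\to X'$ with $ku=f$ and $u'k=g$ exists if and only if the zero map $Z\to Z'$ is a good fill-in, i.e. $(f,g,0)$ is a map of triangles from $(u,v,w)$ to $(u',v',w')$ and it is good.
   Context: $\mathcal{T}$ is a triangulated category with self-equivalence $\Sigma$. "Exact triangle" or "triangle" means distinguished triangle. A map of triangles $(f,g,h)$ from $X\xrightarrow{u}Y\xrightarrow{v}Z\xrightarrow{w}\Sigma X$ to $X'\xrightarrow{u'}Y'\xrightarrow{v'}Z'\xrightarrow{w'}\Sigma X'$ consists of $f\colon X\to X'$, $g\colon Y\to Y'$, $h\colon Z\to Z'$ with $gu=u'f$, $hv=v'g$, $(\Sigma f)w=w'h$. Given $f,g$ with $gu=u'f$, a fill-in is an $h$ making $(f,g,h)$ a map of triangles; the fill-in is good if $(f,g,h)$ is good. The mapping cone of $(f,g,h)$ is the sequence $X'\oplus Y\to Y'\oplus Z\to Z'\oplus\Sigma X\to\Sigma X'\oplus\Sigma Y$ with successive maps $\begin{bmatrix}u'&g\\0&-v\end{bmatrix},\begin{bmatrix}v'&h\\0&-w\end{bmatrix},\begin{bmatrix}w'&\Sigma f\\0&-\Sigma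 u\end{bmatrix}$ (acting on column vectors). $(f,g,h)$ is good if its mapping cone is an exact triangle. *)

theory Defs
  imports "HOL-Algebra.Group"
begin

section \<open>Additive categories\<close>

record ('o, 'm) category =
  Obj :: "'o set"
  Hom :: "'o \<Rightarrow> 'o \<Rightarrow> 'm set"
  Id :: "'o \<Rightarrow> 'm"
  Comp :: "'m \<Rightarrow> 'm \<Rightarrow> 'm"  (infixl \<open>\<cdot>\<index>\<close> 70)

locale category =
  fixes C (structure)
  assumes Hom_disjoint:
      "\<lbrakk>A \<in> Obj C; B \<in> Obj C; A' \<in> Obj C; B' \<in> Obj C; f \<in> Hom C A B; f \<in> Hom C A' B'\<rbrakk>
        \<Longrightarrow> A = A' \<and> B = B'"
    and Id_in_Hom: "A \<in> Obj C \<Longrightarrow> Id C A \<in> Hom C A A"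
    and Comp_in_Hom:
      "\<lbrakk>A \<in> Obj C; B \<in> Obj C; D \<in> Obj C; f \<in> Hom C A B; g \<in> Hom C B D\<rbrakk> \<Longrightarrow> g \<cdot> f \<in> Hom C A D"
    and Comp_Id: "\<lbrakk>A \<in> Obj C; B \<in> Obj C; f \<in> Hom C A B\<rbrakk> \<Longrightarrow> f \<cdot> Id C A = f"
    and Id_Comp: "\<lbrakk>A \<in> Obj C; B \<in> Obj C; f \<in> Hom C A B\<rbrakk> \<Longrightarrow> Id C B \<cdot> f = f"
    and Comp_assoc:
      "\<lbrakk>A \<in> Obj C; B \<in> Obj C; D \<in> Obj C; E \<in> Obj C;
        f \<in> Hom C A B; g \<in> Hom C B D; h \<in> Hom C D E\<rbrakk> \<Longrightarrow> (h \<cdot> g) \<cdot> f = h \<cdot> (g \<cdot> f)"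

definition is_iso :: "('o, 'm, 'x) category_scheme \<Rightarrow> 'o \<Rightarrow> 'o \<Rightarrow> 'm \<Rightarrow> bool" where
  "is_iso C A B f \<longleftrightarrow>
    f \<in> Hom C A B \<and> (\<exists>g\<in>Hom C B A. g \<cdot>\<^bsub>C\<^esub> f = Id C A \<and> f \<cdot>\<^bsub>C\<^esub> g = Id C B)"

definition is_zero_object :: "('o, 'm, 'x) category_scheme \<Rightarrow> 'o \<Rightarrow> bool" where
  "is_zero_object C N \<longleftrightarrow>
    N \<in> Obj C \<and> (\<forall>A\<in>Obj C. (\<exists>!f. f \<in> Hom C A N) \<and> (\<exists>!f. f \<in> Hom C N A))"

record ('o, 'm) preadditive_category = "('o, 'm) category" +
  Add :: "'m \<Rightarrow> 'm \<Rightarrow> 'm"  (infixl \<open>\<boxplus>\<index>\<close> 65)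
  Zero :: "'o \<Rightarrow> 'o \<Rightarrow> 'm"

definition hom_group :: "('o, 'm, 'x) preadditive_category_scheme \<Rightarrow> 'o \<Rightarrow> 'o \<Rightarrow> 'm monoid" where
  "hom_group C A B = \<lparr>carrier = Hom C A B, mult = Add C, one = Zero C A B\<rparr>"

definition Neg :: "('o, 'm, 'x) preadditive_category_scheme \<Rightarrow> 'o \<Rightarrow> 'o \<Rightarrow> 'm \<Rightarrow> 'm" where
  "Neg C A B f = inv\<^bsub>hom_group C A B\<^esub> f"

text \<open>The object of a biproduct, its two injections and its two projections.\<close>

datatype ('o, 'm) biproduct =
  Biproduct (bobj: 'o) (bin1: 'm) (bin2: 'm) (bpr1: 'm) (bpr2: 'm)

fun is_biproduct ::
  "('o, 'm, 'x) preadditive_category_scheme \<Rightarrow> 'o \<Rightarrow> 'o \<Rightarrow> ('o, 'm) biproduct \<Rightarrow> bool" where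
  "is_biproduct C A B (Biproduct P i1 i2 p1 p2) \<longleftrightarrow>
    P \<in> Obj C \<and>
    i1 \<in> Hom C A P \<and> i2 \<in> Hom C B P \<and> p1 \<in> Hom C P A \<and> p2 \<in> Hom C P B \<and>
    p1 \<cdot>\<^bsub>C\<^esub> i1 = Id C A \<and> p2 \<cdot>\<^bsub>C\<^esub> i2 = Id C B \<and>
    p1 \<cdot>\<^bsub>C\<^esub> i2 = Zero C B A \<and> p2 \<cdot>\<^bsub>C\<^esub> i1 = Zero C A B \<and>
    (i1 \<cdot>\<^bsub>C\<^esub> p1) \<boxplus>\<^bsub>C\<^esub> (i2 \<cdot>\<^bsub>C\<^esub> p2) = Id C P"

locale additive_category = category C for C (structure) +
  assumes hom_group: "\<lbrakk>A \<in> Obj C; B \<in> Obj C\<rbrakk> \<Longrightarrow> comm_group (hom_group C A B)"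
    and Comp_Add:
      "\<lbrakk>A \<in> Obj C; B \<in> Obj C; D \<in> Obj C; f \<in> Hom C A B; f' \<in> Hom C A B; g \<in> Hom C B D\<rbrakk>
        \<Longrightarrow> g \<cdot> (f \<boxplus> f') = (g \<cdot> f) \<boxplus> (g \<cdot> f')"
    and Add_Comp:
      "\<lbrakk>A \<in> Obj C; B \<in> Obj C; D \<in> Obj C; f \<in> Hom C A B; g \<in> Hom C B D; g' \<in> Hom C B D\<rbrakk>
        \<Longrightarrow> (g \<boxplus> g') \<cdot> f = (g \<cdot> f) \<boxplus> (g' \<cdot> f)"
    and ex_zero_object: "\<exists>N. is_zero_object C N"
    and ex_biproduct: "\<lbrakk>A \<in> Obj C; B \<in> Obj C\<rbrakk> \<Longrightarrow> \<exists>b. is_biproduct C A B b"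

text \<open>A choice of biproduct for each pair of objects, and the map between biproducts
  \<open>A \<oplus> B \<rightarrow> A' \<oplus> B'\<close> with matrix rows \<open>(a, b)\<close> and \<open>(c, d)\<close>, acting on column vectors.\<close>

definition biprod :: "('o, 'm, 'x) preadditive_category_scheme \<Rightarrow> 'o \<Rightarrow> 'o \<Rightarrow> ('o, 'm) biproduct" where
  "biprod C A B = (SOME b. is_biproduct C A B b)"

definition matrix_map ::
  "('o, 'm, 'x) preadditive_category_scheme \<Rightarrow> ('o, 'm) biproduct \<Rightarrow> ('o, 'm) biproduct
    \<Rightarrow> 'm \<Rightarrow> 'm \<Rightarrow> 'm \<Rightarrow> 'm \<Rightarrow> 'm" where
  "matrix_map C P Q a b c d =
    (bin1 Q \<cdot>\<^bsub>C\<^esub> ((a \<cdot>\<^bsub>C\<^esub> bpr1 P) \<boxplus>\<^bsub>C\<^esub> (b \<cdot>\<^bsub>C\<^esub> bpr2 P))) \<boxplus>\<^bsub>C\<^esub>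
    (bin2 Q \<cdot>\<^bsub>C\<^esub> ((c \<cdot>\<^bsub>C\<^esub> bpr1 P) \<boxplus>\<^bsub>C\<^esub> (d \<cdot>\<^bsub>C\<^esub> bpr2 P)))"


section \<open>Additive self-equivalences\<close>

definition is_endofunctor ::
  "('o, 'm, 'x) category_scheme \<Rightarrow> ('o \<Rightarrow> 'o) \<Rightarrow> ('m \<Rightarrow> 'm) \<Rightarrow> bool" where
  "is_endofunctor C Fo Fm \<longleftrightarrow>
    (\<forall>A\<in>Obj C. Fo A \<in> Obj C \<and> Fm (Id C A) = Id C (Fo A)) \<and>
    (\<forall>A\<in>Obj C. \<forall>B\<in>Obj C. \<forall>f\<in>Hom C A B. Fm f \<in> Hom C (Fo A) (Fo B)) \<and>
    (\<forall>A\<in>Obj C. \<forall>B\<in>Obj C. \<forall>D\<in>Obj C. \<forall>f\<in>Hom C A B. \<forall>g\<in>Hom C B D.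
      Fm (g \<cdot>\<^bsub>C\<^esub> f) = Fm g \<cdot>\<^bsub>C\<^esub> Fm f)"

definition is_natural_iso ::
  "('o, 'm, 'x) category_scheme \<Rightarrow> ('o \<Rightarrow> 'o) \<Rightarrow> ('m \<Rightarrow> 'm) \<Rightarrow> ('o \<Rightarrow> 'o) \<Rightarrow> ('m \<Rightarrow> 'm)
    \<Rightarrow> ('o \<Rightarrow> 'm) \<Rightarrow> bool" where
  "is_natural_iso C Fo Fm Go Gm \<eta> \<longleftrightarrow>
    (\<forall>A\<in>Obj C. is_iso C (Fo A) (Go A) (\<eta> A)) \<and>
    (\<forall>A\<in>Obj C. \<forall>B\<in>Obj C. \<forall>f\<in>Hom C A B. Gm f \<cdot>\<^bsub>C\<^esub> \<eta> A = \<eta> B \<cdot>\<^bsub>C\<^esub> Fm f)"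

definition is_self_equivalence ::
  "('o, 'm, 'x) category_scheme \<Rightarrow> ('o \<Rightarrow> 'o) \<Rightarrow> ('m \<Rightarrow> 'm) \<Rightarrow> bool" where
  "is_self_equivalence C Fo Fm \<longleftrightarrow>
    is_endofunctor C Fo Fm \<and>
    (\<exists>Go Gm \<eta> \<epsilon>. is_endofunctor C Go Gm \<and>
      is_natural_iso C id id (Go \<circ> Fo) (Gm \<circ> Fm) \<eta> \<and>
      is_natural_iso C (Fo \<circ> Go) (Fm \<circ> Gm) id id \<epsilon>)"


section \<open>Triangulated categories\<close>

text \<open>\<open>Triangle X Y Z u v w\<close> is the sequence \<open>X \<rightarrow> Y \<rightarrow> Z \<rightarrow> \<Sigma>X\<close> with maps \<open>u\<close>, \<open>v\<close>, \<open>w\<close>.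
  \<open>Susp\<close> and \<open>SuspMap\<close> are \<open>\<Sigma>\<close> on objects and on maps.\<close>

datatype ('o, 'm) triangle = Triangle 'o 'o 'o 'm 'm 'm

record ('o, 'm) triangulated_category = "('o, 'm) preadditive_category" +
  Susp :: "'o \<Rightarrow> 'o"
  SuspMap :: "'m \<Rightarrow> 'm"
  Exact :: "('o, 'm) triangle set"

fun is_candidate ::
  "('o, 'm, 'x) triangulated_category_scheme \<Rightarrow> ('o, 'm) triangle \<Rightarrow> bool" where
  "is_candidate T (Triangle X Y Z u v w) \<longleftrightarrow>
    X \<in> Obj T \<and> Y \<in> Obj T \<and> Z \<in> Obj T \<and>
    u \<in> Hom T X Y \<and> v \<in> Hom T Y Z \<and> w \<in> Hom T Z (Susp T X)"

fun is_triangle_map ::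
  "('o, 'm, 'x) triangulated_category_scheme \<Rightarrow> ('o, 'm) triangle \<Rightarrow> ('o, 'm) triangle
    \<Rightarrow> 'm \<Rightarrow> 'm \<Rightarrow> 'm \<Rightarrow> bool" where
  "is_triangle_map T (Triangle X Y Z u v w) (Triangle X' Y' Z' u' v' w') f g h \<longleftrightarrow>
    f \<in> Hom T X X' \<and> g \<in> Hom T Y Y' \<and> h \<in> Hom T Z Z' \<and>
    g \<cdot>\<^bsub>T\<^esub> u = u' \<cdot>\<^bsub>T\<^esub> f \<and> h \<cdot>\<^bsub>T\<^esub> v = v' \<cdot>\<^bsub>T\<^esub> g \<and> SuspMap T f \<cdot>\<^bsub>T\<^esub> w = w' \<cdot>\<^bsub>T\<^esub> h"

fun is_triangle_iso ::
  "('o, 'm, 'x) triangulated_category_scheme \<Rightarrow> ('o, 'm) triangle \<Rightarrow> ('o, 'm) triangle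
    \<Rightarrow> 'm \<Rightarrow> 'm \<Rightarrow> 'm \<Rightarrow> bool" where
  "is_triangle_iso T (Triangle X Y Z u v w) (Triangle X' Y' Z' u' v' w') f g h \<longleftrightarrow>
    is_triangle_map T (Triangle X Y Z u v w) (Triangle X' Y' Z' u' v' w') f g h \<and>
    is_iso T X X' f \<and> is_iso T Y Y' g \<and> is_iso T Z Z' h"

locale triangulated_category = additive_category T for T (structure) +
  assumes Susp_equivalence: "is_self_equivalence T (Susp T) (SuspMap T)"
    and Susp_additive:
      "\<lbrakk>A \<in> Obj T; B \<in> Obj T; f \<in> Hom T A B; g \<in> Hom T A B\<rbrakk>
        \<Longrightarrow> SuspMap T (f \<boxplus> g) = SuspMap T f \<boxplus> SuspMap T g"
    and Exact_candidate: "t \<in> Exact T \<Longrightarrow> is_candidate T t"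
    and TR1_iso:
      "\<lbrakk>t \<in> Exact T; is_candidate T t'; is_triangle_iso T t t' f g h\<rbrakk> \<Longrightarrow> t' \<in> Exact T"
    and TR1_Id:
      "\<lbrakk>X \<in> Obj T; is_zero_object T N\<rbrakk>
        \<Longrightarrow> Triangle X X N (Id T X) (Zero T X N) (Zero T N (Susp T X)) \<in> Exact T"
    and TR1_cone:
      "\<lbrakk>X \<in> Obj T; Y \<in> Obj T; u \<in> Hom T X Y\<rbrakk> \<Longrightarrow> \<exists>Z v w. Triangle X Y Z u v w \<in> Exact T"
    and TR2:
      "is_candidate T (Triangle X Y Z u v w) \<Longrightarrow>
        Triangle X Y Z u v w \<in> Exact T \<longleftrightarrow>
        Triangle Y Z (Susp T X) v w (Neg T (Susp T X) (Susp T Y) (SuspMap T u)) \<in> Exact T"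
    and TR3:
      "\<lbrakk>Triangle X Y Z u v w \<in> Exact T; Triangle X' Y' Z' u' v' w' \<in> Exact T;
        f \<in> Hom T X X'; g \<in> Hom T Y Y'; g \<cdot> u = u' \<cdot> f\<rbrakk>
        \<Longrightarrow> \<exists>h. is_triangle_map T (Triangle X Y Z u v w) (Triangle X' Y' Z' u' v' w') f g h"
    \<comment> \<open>the octahedral axiom\<close>
    and TR4:
      "\<lbrakk>Triangle X Y Z' u i i' \<in> Exact T;
        Triangle Y Z X' v j j' \<in> Exact T;
        Triangle X Z Y' (v \<cdot> u) k k' \<in> Exact T\<rbrakk>
        \<Longrightarrow> \<exists>a b. Triangle Z' Y' X' a b (SuspMap T i \<cdot> j') \<in> Exact T \<and>
          is_triangle_map T (Triangle X Y Z' u i i') (Triangle X Z Y' (v \<cdot> u) k k') (Id T X) v a \<and>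
          is_triangle_map T (Triangle X Z Y' (v \<cdot> u) k k') (Triangle Y Z X' v j j') u (Id T Z) b"


section \<open>Mapping cones and good maps\<close>

text \<open>The third map of a mapping cone lands in \<open>\<Sigma>X' \<oplus> \<Sigma>Y\<close>, which is identified with
  \<open>\<Sigma>(X' \<oplus> Y)\<close> along the canonical isomorphism with components \<open>\<Sigma>i\<^sub>1\<close> and \<open>\<Sigma>i\<^sub>2\<close>.\<close>

definition susp_biprod_map ::
  "('o, 'm, 'x) triangulated_category_scheme \<Rightarrow> 'o \<Rightarrow> 'o \<Rightarrow> 'm" where
  "susp_biprod_map T A B =
    (SuspMap T (bin1 (biprod T A B)) \<cdot>\<^bsub>T\<^esub> bpr1 (biprod T (Susp T A) (Susp T B))) \<boxplus>\<^bsub>T\<^esub>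
    (SuspMap T (bin2 (biprod T A B)) \<cdot>\<^bsub>T\<^esub> bpr2 (biprod T (Susp T A) (Susp T B)))"

fun mapping_cone ::
  "('o, 'm, 'x) triangulated_category_scheme \<Rightarrow> ('o, 'm) triangle \<Rightarrow> ('o, 'm) triangle
    \<Rightarrow> 'm \<Rightarrow> 'm \<Rightarrow> 'm \<Rightarrow> ('o, 'm) triangle" where
  "mapping_cone T (Triangle X Y Z u v w) (Triangle X' Y' Z' u' v' w') f g h =
    (let P1 = biprod T X' Y;
         P2 = biprod T Y' Z;
         P3 = biprod T Z' (Susp T X);
         P4 = biprod T (Susp T X') (Susp T Y)
     in Triangle (bobj P1) (bobj P2) (bobj P3)
          (matrix_map T P1 P2
            u'             g
            (Zero T X' Z)  (Neg T Y Z v))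
          (matrix_map T P2 P3
            v'                      h
            (Zero T Y' (Susp T X))  (Neg T Z (Susp T X) w))
          (susp_biprod_map T X' Y \<cdot>\<^bsub>T\<^esub>
           matrix_map T P3 P4
            w'                      (SuspMap T f)
            (Zero T Z' (Susp T Y))  (Neg T (Susp T X) (Susp T Y) (SuspMap T u))))"

definition good_triangle_map ::
  "('o, 'm, 'x) triangulated_category_scheme \<Rightarrow> ('o, 'm) triangle \<Rightarrow> ('o, 'm) triangle
    \<Rightarrow> 'm \<Rightarrow> 'm \<Rightarrow> 'm \<Rightarrow> bool" where
  "good_triangle_map T t t' f g h \<longleftrightarrow>
    is_triangle_map T t t' f g h \<and> mapping_cone T t t' f g h \<in> Exact T"

end

theory Submission
  imports Defs
begin

text \<open>
  A lift \<open>k\<close> makes the mapping cone of \<open>(f, g, 0)\<close> the direct sum of the exact triangle on \<open>u'\<close> and the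
  negated rotation \<open>(-v, -w, -\<Sigma>u)\<close> of the exact triangle on \<open>u\<close>: include \<open>Y\<close> into \<open>X' \<oplus> Y\<close> by
  \<open>(-k, 1)\<close>. Conversely, if the cone is exact, the inclusions of \<open>Z\<close> and \<open>\<Sigma>X\<close> extend to a map from
  the negated rotation, with first component \<open>(b, d) : Y \<rightarrow> X' \<oplus> Y\<close>. Comparing entries gives \<open>f = -b u\<close>,
  \<open>u' b + g d = 0\<close>, \<open>v d = v\<close> and \<open>d u = u\<close>. So \<open>d = 1 + e\<close> where \<open>e\<close> factors through \<open>u\<close> and
  \<open>e u = 0\<close>, whence \<open>e\<^sup>2 = 0\<close> and \<open>k = -b (1 - e)\<close> is a lift.
\<close>

section \<open>Partial composition with sources and targets\<close>

text \<open>Since hom-sets are disjoint, source and target can be read off an arrow (they are junk unless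
  \<open>arr f\<close>). All typing side conditions then become equations that the simplifier can discharge.\<close>

context category
begin

definition arr :: "'b \<Rightarrow> bool" where
  "arr f \<longleftrightarrow> (\<exists>A\<in>Obj C. \<exists>B\<in>Obj C. f \<in> Hom C A B)"

definition src :: "'b \<Rightarrow> 'a" where
  "src f = (THE A. A \<in> Obj C \<and> (\<exists>B\<in>Obj C. f \<in> Hom C A B))"

definition tgt :: "'b \<Rightarrow> 'a" where
  "tgt f = (THE B. B \<in> Obj C \<and> (\<exists>A\<in>Obj C. f \<in> Hom C A B))"

lemma src_eq: "\<lbrakk>A \<in> Obj C; B \<in> Obj C; f \<in> Hom C A B\<rbrakk> \<Longrightarrow> src f = A"
  unfolding src_def using Hom_disjoint by (intro the_equality) blast+

lemma tgt_eq: "\<lbrakk>A \<in> Obj C; B \<in> Obj C; f \<in> Hom C A B\<rbrakk> \<Longrightarrow> tgt f = B"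
  unfolding tgt_def using Hom_disjoint by (intro the_equality) blast+

lemma in_Hom_iff [simp]:
  "\<lbrakk>A \<in> Obj C; B \<in> Obj C\<rbrakk> \<Longrightarrow> f \<in> Hom C A B \<longleftrightarrow> arr f \<and> src f = A \<and> tgt f = B"
  unfolding arr_def using src_eq tgt_eq by metis

lemma arr_objs [simp]: "arr f \<Longrightarrow> src f \<in> Obj C" "arr f \<Longrightarrow> tgt f \<in> Obj C"
  unfolding arr_def using src_eq tgt_eq by metis+

lemma arr_in_Hom: "arr f \<Longrightarrow> f \<in> Hom C (src f) (tgt f)"
  by simp

lemma arr_Id [simp]:
  assumes "A \<in> Obj C"
  shows "arr (Id C A)" "src (Id C A) = A" "tgt (Id C A) = A"
  using Id_in_Hom[OF assms] assms by simp_all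

lemma arr_Comp [simp]:
  assumes "arr f" "arr g" "src g = tgt f"
  shows "arr (g \<cdot> f)" "src (g \<cdot> f) = src f" "tgt (g \<cdot> f) = tgt g"
  using Comp_in_Hom[of "src f" "tgt f" "tgt g" f g] assms by simp_all

lemma Comp_Id_arr [simp]: "\<lbrakk>arr f; src f = A\<rbrakk> \<Longrightarrow> f \<cdot> Id C A = f"
  using Comp_Id[of "src f" "tgt f" f] by auto

lemma Id_Comp_arr [simp]: "\<lbrakk>arr f; tgt f = A\<rbrakk> \<Longrightarrow> Id C A \<cdot> f = f"
  using Id_Comp[of "src f" "tgt f" f] by auto

lemma Comp_assoc_arr [simp]:
  "\<lbrakk>arr f; arr g; arr h; src g = tgt f; src h = tgt g\<rbrakk> \<Longrightarrow> (h \<cdot> g) \<cdot> f = h \<cdot> (g \<cdot> f)"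
  using Comp_assoc[of "src f" "tgt f" "tgt g" "tgt h" f g h] by simp

text \<open>Simplification associates composites to the right, so an equation
  \<open>h \<cdot> g = k\<close> would not match inside \<open>h \<cdot> (g \<cdot> f)\<close>. This
  form turns it into a rewrite rule that does.\<close>

lemma Comp_reassoc:
  "\<lbrakk>h \<cdot> g = k; arr g; arr h; src h = tgt g; arr f; tgt f = src g\<rbrakk> \<Longrightarrow> h \<cdot> (g \<cdot> f) = k \<cdot> f"
  using Comp_assoc_arr[of f g h] by simp

section \<open>Isomorphisms and cancellation\<close>

lemma is_isoE:
  assumes "is_iso C A B f" "A \<in> Obj C" "B \<in> Obj C"
  obtains g where "arr f" "src f = A" "tgt f = B" "arr g" "src g = B" "tgt g = A"
    "g \<cdot> f = Id C A" "f \<cdot> g = Id C B"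
  using assms unfolding is_iso_def by auto

lemma is_iso_Id: "A \<in> Obj C \<Longrightarrow> is_iso C A A (Id C A)"
  unfolding is_iso_def by (intro conjI bexI[of _ "Id C A"]) simp_all

text \<open>A left inverse and a right inverse agree, since l = l (f r) = (l f) r = r. Hence the two
  may come from unrelated constructions.\<close>

lemma is_iso_inverse_arrs:
  assumes f: "arr f" "src f = A" "tgt f = B" and l: "arr l" "src l = B" "tgt l = A" "l \<cdot> f = Id C A"
    and r: "arr r" "src r = B" "tgt r = A" "f \<cdot> r = Id C B"
  shows "is_iso C A B f"
proof -
  have AB: "A \<in> Obj C" "B \<in> Obj C" using arr_objs f by metis+
  have "l = l \<cdot> (f \<cdot> r)" using l r AB by simp
  also have "\<dots> = (l \<cdot> f) \<cdot> r" using f l(1-3) r(1-3) by simp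
  also have "\<dots> = r" using f l(4) r AB by simp
  finally show ?thesis
    unfolding is_iso_def using f l r AB by (intro conjI bexI[of _ l]) simp_all
qed

lemma cancel_iso_left:
  assumes "is_iso C A B e" "A \<in> Obj C" "B \<in> Obj C" "arr f" "arr g" "tgt f = A" "tgt g = A"
    "e \<cdot> f = e \<cdot> g"
  shows "f = g"
proof -
  obtain d where d: "arr e" "src e = A" "tgt e = B" "arr d" "src d = B" "tgt d = A"
    "d \<cdot> e = Id C A" using assms is_isoE by metis
  have "f = (d \<cdot> e) \<cdot> f" using d assms by simp
  also have "\<dots> = d \<cdot> (e \<cdot> f)" using d(1-6) assms(2-7) by (subst Comp_assoc_arr) simp_all
  also have "\<dots> = d \<cdot> (e \<cdot> g)" using assms by simp
  also have "\<dots> = (d \<cdot> e) \<cdot> g" using d(1-6) assms(2-7) by (subst Comp_assoc_arr[symmetric]) simp_all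
  also have "\<dots> = g" using d assms by simp
  finally show ?thesis .
qed

lemma cancel_iso_right:
  assumes "is_iso C A B e" "A \<in> Obj C" "B \<in> Obj C" "arr f" "arr g" "src f = B" "src g = B"
    "f \<cdot> e = g \<cdot> e"
  shows "f = g"
proof -
  obtain d where d: "arr e" "src e = A" "tgt e = B" "arr d" "src d = B" "tgt d = A"
    "e \<cdot> d = Id C B" using assms is_isoE by metis
  have "f = f \<cdot> (e \<cdot> d)" using d assms by simp
  also have "\<dots> = (f \<cdot> e) \<cdot> d" using d(1-6) assms(2-7) by (subst Comp_assoc_arr[symmetric]) simp_all
  also have "\<dots> = (g \<cdot> e) \<cdot> d" using assms by simp
  also have "\<dots> = g \<cdot> (e \<cdot> d)" using d(1-6) assms(2-7) by (subst Comp_assoc_arr) simp_all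
  also have "\<dots> = g" using d assms by simp
  finally show ?thesis .
qed

section \<open>Functors, natural isomorphisms and equivalences\<close>

lemma natural_isoD:
  assumes "is_natural_iso C Fo Fm Go Gm \<eta>"
  shows "A \<in> Obj C \<Longrightarrow> is_iso C (Fo A) (Go A) (\<eta> A)"
    and "arr f \<Longrightarrow> Gm f \<cdot> \<eta> (src f) = \<eta> (tgt f) \<cdot> Fm f"
  using assms unfolding is_natural_iso_def by auto

lemma endofunctorD:
  assumes "is_endofunctor C Fo Fm"
  shows "A \<in> Obj C \<Longrightarrow> Fo A \<in> Obj C"
    and "A \<in> Obj C \<Longrightarrow> Fm (Id C A) = Id C (Fo A)"
    and "arr f \<Longrightarrow> arr (Fm f)"
    and "arr f \<Longrightarrow> src (Fm f) = Fo (src f)"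
    and "arr f \<Longrightarrow> tgt (Fm f) = Fo (tgt f)"
    and "\<lbrakk>arr f; arr g; src g = tgt f\<rbrakk> \<Longrightarrow> Fm (g \<cdot> f) = Fm g \<cdot> Fm f"
proof -
  show o: "A \<in> Obj C \<Longrightarrow> Fo A \<in> Obj C" for A
    using assms unfolding is_endofunctor_def by blast
  show "A \<in> Obj C \<Longrightarrow> Fm (Id C A) = Id C (Fo A)"
    using assms unfolding is_endofunctor_def by blast
  have m: "arr f \<Longrightarrow> Fm f \<in> Hom C (Fo (src f)) (Fo (tgt f))"
    using assms arr_objs arr_in_Hom unfolding is_endofunctor_def by blast
  from m show "arr f \<Longrightarrow> arr (Fm f)" "arr f \<Longrightarrow> src (Fm f) = Fo (src f)"
    "arr f \<Longrightarrow> tgt (Fm f) = Fo (tgt f)" by (simp_all add: o)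
  show "\<lbrakk>arr f; arr g; src g = tgt f\<rbrakk> \<Longrightarrow> Fm (g \<cdot> f) = Fm g \<cdot> Fm f"
    using assms arr_objs arr_in_Hom[of f] arr_in_Hom[of g] unfolding is_endofunctor_def by metis
qed

text \<open>Naturality of the counit expresses \<open>f \<cdot> \<epsilon> (src f)\<close> through
  \<open>Fm (Gm f)\<close>, and the counit can be cancelled on the right.\<close>

lemma faithful_of_natural_iso_to_id:
  assumes G: "is_endofunctor C Go Gm" and F: "is_endofunctor C Fo Fm"
    and e: "is_natural_iso C (Fo \<circ> Go) (Fm \<circ> Gm) id id \<epsilon>"
    and fg: "arr f" "arr g" "src f = src g" "tgt f = tgt g" "Gm f = Gm g"
  shows "f = g"
proof -
  have "f \<cdot> \<epsilon> (src f) = g \<cdot> \<epsilon> (src g)"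
    using natural_isoD(2)[OF e fg(1)] natural_isoD(2)[OF e fg(2)] fg by simp
  then show ?thesis
    by - (rule cancel_iso_right[OF natural_isoD(1)[OF e, of "src g"]],
        simp_all add: fg(1-4) endofunctorD[OF F] endofunctorD[OF G])
qed

text \<open>Here naturality of the unit expresses \<open>\<eta> (tgt f) \<cdot> f\<close> through
  \<open>Gm (Fm f)\<close>, and the unit is cancelled on the left.\<close>

lemma faithful_of_natural_iso_from_id:
  assumes G: "is_endofunctor C Go Gm" and F: "is_endofunctor C Fo Fm"
    and e: "is_natural_iso C id id (Go \<circ> Fo) (Gm \<circ> Fm) \<eta>"
    and fg: "arr f" "arr g" "src f = src g" "tgt f = tgt g" "Fm f = Fm g"
  shows "f = g"
proof -
  have "\<eta> (tgt f) \<cdot> f = \<eta> (tgt g) \<cdot> g"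
    using natural_isoD(2)[OF e fg(1)] natural_isoD(2)[OF e fg(2)] fg by simp
  then show ?thesis
    by - (rule cancel_iso_left[OF natural_isoD(1)[OF e, of "tgt g"]],
        simp_all add: fg(1-4) endofunctorD[OF F] endofunctorD[OF G])
qed

lemma self_equivalence_endofunctor:
  "is_self_equivalence C Fo Fm \<Longrightarrow> is_endofunctor C Fo Fm"
  unfolding is_self_equivalence_def by blast

lemma self_equivalence_faithful:
  assumes "is_self_equivalence C Fo Fm"
    and "arr f" "arr g" "src f = src g" "tgt f = tgt g" "Fm f = Fm g"
  shows "f = g"
  using assms faithful_of_natural_iso_from_id unfolding is_self_equivalence_def by blast

text \<open>The preimage of \<open>h\<close> is \<open>Gm h\<close> conjugated by the unit.
  Naturality then gives \<open>Gm (Fm f) = Gm h\<close>, and faithfulness of \<open>Gm\<close>,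
  which comes from the counit, finishes.\<close>

lemma self_equivalence_full:
  assumes "is_self_equivalence C Fo Fm" "A \<in> Obj C" "B \<in> Obj C"
    and h: "arr h" "src h = Fo A" "tgt h = Fo B"
  obtains f where "arr f" "src f = A" "tgt f = B" "Fm f = h"
proof -
  obtain Go Gm \<eta> \<epsilon> where F: "is_endofunctor C Fo Fm" and G: "is_endofunctor C Go Gm"
    and eta: "is_natural_iso C id id (Go \<circ> Fo) (Gm \<circ> Fm) \<eta>"
    and eps: "is_natural_iso C (Fo \<circ> Go) (Fm \<circ> Gm) id id \<epsilon>"
    using assms(1) unfolding is_self_equivalence_def by blast
  note D [simp] = endofunctorD[OF F] endofunctorD[OF G]
  note [simp] = assms(2,3) h
  have iA: "is_iso C A (Go (Fo A)) (\<eta> A)" and iB: "is_iso C B (Go (Fo B)) (\<eta> B)"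
    using natural_isoD(1)[OF eta, of A] natural_isoD(1)[OF eta, of B] by simp_all
  have [simp]: "arr (\<eta> A)" "src (\<eta> A) = A" "tgt (\<eta> A) = Go (Fo A)"
    by (rule is_isoE[OF iA]; simp)+
  obtain d where [simp]: "arr (\<eta> B)" "src (\<eta> B) = B" "tgt (\<eta> B) = Go (Fo B)"
    "arr d" "src d = Go (Fo B)" "tgt d = B" and d: "\<eta> B \<cdot> d = Id C (Go (Fo B))"
    by (rule is_isoE[OF iB]) simp_all
  define f where "f = d \<cdot> (Gm h \<cdot> \<eta> A)"
  have f [simp]: "arr f" "src f = A" "tgt f = B" unfolding f_def by simp_all
  have "Gm (Fm f) \<cdot> \<eta> A = \<eta> B \<cdot> f"
    using natural_isoD(2)[OF eta f(1)] by simp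
  also have "\<dots> = Gm h \<cdot> \<eta> A" unfolding f_def by (simp add: Comp_reassoc[OF d])
  finally have "Gm (Fm f) = Gm h" using cancel_iso_right[OF iA] by simp
  then have "Fm f = h"
    using faithful_of_natural_iso_to_id[OF G F eps, of "Fm f" h] by simp
  from that[OF f this] show ?thesis .
qed

end

section \<open>Additive calculus and biproducts\<close>

context additive_category
begin

lemma hom_group_sel [simp]:
  "carrier (hom_group C A B) = Hom C A B" "mult (hom_group C A B) = Add C"
  "one (hom_group C A B) = Zero C A B"
  unfolding hom_group_def by simp_all

lemma arr_Add [simp]:
  assumes "arr f" "arr g" "src f = src g" "tgt f = tgt g"
  shows "arr (f \<boxplus> g)" "src (f \<boxplus> g) = src g" "tgt (f \<boxplus> g) = tgt g"
proof -
  interpret comm_group "hom_group C (src g) (tgt g)" using assms by (simp add: hom_group)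
  show "arr (f \<boxplus> g)" "src (f \<boxplus> g) = src g" "tgt (f \<boxplus> g) = tgt g"
    using m_closed[of f g] assms by simp_all
qed

lemma arr_Zero [simp]:
  assumes "A \<in> Obj C" "B \<in> Obj C"
  shows "arr (Zero C A B)" "src (Zero C A B) = A" "tgt (Zero C A B) = B"
proof -
  interpret comm_group "hom_group C A B" using assms by (simp add: hom_group)
  show "arr (Zero C A B)" "src (Zero C A B) = A" "tgt (Zero C A B) = B"
    using one_closed assms by simp_all
qed

lemma arr_Neg [simp]:
  assumes "arr f" "src f = A" "tgt f = B"
  shows "arr (Neg C A B f)" "src (Neg C A B f) = A" "tgt (Neg C A B f) = B"
proof -
  have AB: "A \<in> Obj C" "B \<in> Obj C" using assms arr_objs by metis+
  interpret comm_group "hom_group C A B" using AB by (simp add: hom_group)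
  show "arr (Neg C A B f)" "src (Neg C A B f) = A" "tgt (Neg C A B f) = B"
    using inv_closed[of f] assms AB unfolding Neg_def by simp_all
qed

lemma Add_assoc [simp]:
  assumes "arr f" "arr g" "arr h" "src f = src g" "tgt f = tgt g" "src g = src h" "tgt g = tgt h"
  shows "(f \<boxplus> g) \<boxplus> h = f \<boxplus> (g \<boxplus> h)"
proof -
  interpret comm_group "hom_group C (src h) (tgt h)" using assms by (simp add: hom_group)
  show ?thesis using m_assoc[of f g h] assms by simp
qed

lemma Add_commute:
  assumes "arr f" "arr g" "src f = src g" "tgt f = tgt g"
  shows "f \<boxplus> g = g \<boxplus> f"
proof -
  interpret comm_group "hom_group C (src g) (tgt g)" using assms by (simp add: hom_group)
  show ?thesis using m_comm[of f g] assms by simp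
qed

lemma Add_left_commute:
  assumes "arr f" "arr g" "arr h" "src f = src g" "tgt f = tgt g" "src g = src h" "tgt g = tgt h"
  shows "f \<boxplus> (g \<boxplus> h) = g \<boxplus> (f \<boxplus> h)"
  using assms Add_assoc[of f g h] Add_assoc[of g f h] Add_commute[of f g] by simp

lemma Add_Zero [simp]:
  assumes "arr f" "src f = A" "tgt f = B"
  shows "f \<boxplus> Zero C A B = f" "Zero C A B \<boxplus> f = f"
proof -
  have AB: "A \<in> Obj C" "B \<in> Obj C" using assms arr_objs by metis+
  interpret comm_group "hom_group C A B" using AB by (simp add: hom_group)
  show "f \<boxplus> Zero C A B = f" "Zero C A B \<boxplus> f = f"
    using r_one[of f] l_one[of f] assms AB by simp_all
qed

lemma Add_Neg [simp]:
  assumes "arr f" "src f = A" "tgt f = B"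
  shows "f \<boxplus> Neg C A B f = Zero C A B" "Neg C A B f \<boxplus> f = Zero C A B"
proof -
  have AB: "A \<in> Obj C" "B \<in> Obj C" using assms arr_objs by metis+
  interpret comm_group "hom_group C A B" using AB by (simp add: hom_group)
  show "f \<boxplus> Neg C A B f = Zero C A B" "Neg C A B f \<boxplus> f = Zero C A B"
    using r_inv[of f] l_inv[of f] assms AB unfolding Neg_def by simp_all
qed

lemma Neg_unique:
  assumes "arr f" "src f = A" "tgt f = B" "arr g" "src g = A" "tgt g = B" "g \<boxplus> f = Zero C A B"
  shows "g = Neg C A B f"
proof -
  have AB: "A \<in> Obj C" "B \<in> Obj C" using assms arr_objs by metis+
  interpret comm_group "hom_group C A B" using AB by (simp add: hom_group)
  show ?thesis using inv_equality[of g f] assms AB unfolding Neg_def by simp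
qed

lemma Neg_Neg [simp]:
  assumes "arr f" "src f = A" "tgt f = B"
  shows "Neg C A B (Neg C A B f) = f"
  by (rule Neg_unique[symmetric]) (use assms in simp_all)

lemma Neg_Zero [simp]:
  "\<lbrakk>A \<in> Obj C; B \<in> Obj C\<rbrakk> \<Longrightarrow> Neg C A B (Zero C A B) = Zero C A B"
  by (rule Neg_unique[symmetric]) simp_all

lemma Add_Neg_cancel [simp]:
  assumes "arr f" "src f = A" "tgt f = B" "arr g" "src g = A" "tgt g = B"
  shows "f \<boxplus> (Neg C A B f \<boxplus> g) = g" "Neg C A B f \<boxplus> (f \<boxplus> g) = g"
  using assms Add_assoc[of f "Neg C A B f" g] Add_assoc[of "Neg C A B f" f g] by simp_all

lemma Neg_Add [simp]:
  assumes "arr f" "src f = A" "tgt f = B" "arr g" "src g = A" "tgt g = B"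
  shows "Neg C A B (f \<boxplus> g) = Neg C A B f \<boxplus> Neg C A B g"
  by (rule Neg_unique[symmetric])
    (use assms Add_left_commute[of "Neg C A B g" f g] in \<open>simp_all add: Add_left_commute\<close>)

text \<open>Used to see that additive operations preserve zero maps: applied to 0 + 0 = 0,
  additivity makes the image of 0 idempotent.\<close>

lemma Add_idem_Zero:
  assumes "arr f" "src f = A" "tgt f = B" "f \<boxplus> f = f"
  shows "f = Zero C A B"
proof -
  have "f = f \<boxplus> (f \<boxplus> Neg C A B f)" using assms(1-3) by simp
  also have "\<dots> = (f \<boxplus> f) \<boxplus> Neg C A B f" using assms(1-3) by (subst Add_assoc[symmetric]) simp_all
  also have "\<dots> = Zero C A B" using assms by simp
  finally show ?thesis .
qed

lemma Comp_Add_arr [simp]: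
  "\<lbrakk>arr f; arr f'; arr g; src f = src f'; tgt f = tgt f'; src g = tgt f'\<rbrakk>
    \<Longrightarrow> g \<cdot> (f \<boxplus> f') = (g \<cdot> f) \<boxplus> (g \<cdot> f')"
  using Comp_Add[of "src f" "tgt f" "tgt g" f f' g] by simp

lemma Add_Comp_arr [simp]:
  "\<lbrakk>arr f; arr g; arr g'; src g = src g'; tgt g = tgt g'; src g' = tgt f\<rbrakk>
    \<Longrightarrow> (g \<boxplus> g') \<cdot> f = (g \<cdot> f) \<boxplus> (g' \<cdot> f)"
  using Add_Comp[of "src f" "tgt f" "tgt g" f g g'] by simp

lemma Comp_Zero [simp]:
  assumes "A \<in> Obj C" "arr g" "src g = B"
  shows "g \<cdot> Zero C A B = Zero C A (tgt g)"
proof -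
  have [simp]: "B \<in> Obj C" using assms arr_objs by metis
  have "g \<cdot> (Zero C A B \<boxplus> Zero C A B) = (g \<cdot> Zero C A B) \<boxplus> (g \<cdot> Zero C A B)"
    by (rule Comp_Add_arr) (use assms in simp_all)
  then show ?thesis using assms by (intro Add_idem_Zero) simp_all
qed

lemma Zero_Comp [simp]:
  assumes "B \<in> Obj C" "arr f" "tgt f = A"
  shows "Zero C A B \<cdot> f = Zero C (src f) B"
proof -
  have [simp]: "A \<in> Obj C" using assms arr_objs by metis
  have "(Zero C A B \<boxplus> Zero C A B) \<cdot> f = (Zero C A B \<cdot> f) \<boxplus> (Zero C A B \<cdot> f)"
    by (rule Add_Comp_arr) (use assms in simp_all)
  then show ?thesis using assms by (intro Add_idem_Zero) simp_all
qed

lemma Comp_Neg [simp]: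
  assumes "arr f" "src f = A" "tgt f = B" "arr g" "src g = B"
  shows "g \<cdot> Neg C A B f = Neg C A (tgt g) (g \<cdot> f)"
proof (rule Neg_unique)
  have "A \<in> Obj C" using assms arr_objs by metis
  have "g \<cdot> (Neg C A B f \<boxplus> f) = g \<cdot> Neg C A B f \<boxplus> (g \<cdot> f)"
    by (rule Comp_Add_arr) (use assms in simp_all)
  then show "g \<cdot> Neg C A B f \<boxplus> (g \<cdot> f) = Zero C A (tgt g)" using assms \<open>A \<in> Obj C\<close> by simp
qed (use assms in simp_all)

lemma Neg_Comp [simp]:
  assumes "arr g" "src g = A" "tgt g = B" "arr f" "tgt f = A"
  shows "Neg C A B g \<cdot> f = Neg C (src f) B (g \<cdot> f)"
proof (rule Neg_unique)
  have "B \<in> Obj C" using assms arr_objs by metis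
  have "(Neg C A B g \<boxplus> g) \<cdot> f = Neg C A B g \<cdot> f \<boxplus> (g \<cdot> f)"
    by (rule Add_Comp_arr) (use assms in simp_all)
  then show "Neg C A B g \<cdot> f \<boxplus> (g \<cdot> f) = Zero C (src f) B" using assms \<open>B \<in> Obj C\<close> by simp
qed (use assms in simp_all)

lemma Neg_inject:
  assumes "Neg C A B f = Neg C A B g"
    and "arr f" "src f = A" "tgt f = B" "arr g" "src g = A" "tgt g = B"
  shows "f = g"
  using assms Neg_Neg by metis

lemma Neg_eq_Zero_iff:
  assumes "arr f" "src f = A" "tgt f = B"
  shows "Neg C A B f = Zero C A B \<longleftrightarrow> f = Zero C A B"
  using assms Neg_Neg Neg_Zero arr_objs by metis

section \<open>Zero objects\<close>

lemma zero_object_Obj: "is_zero_object C N \<Longrightarrow> N \<in> Obj C"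
  unfolding is_zero_object_def by blast

lemma arr_to_zero_object:
  assumes "is_zero_object C N" "arr f" "tgt f = N"
  shows "f = Zero C (src f) N"
  using assms unfolding is_zero_object_def by (metis arr_Zero arr_in_Hom arr_objs(1))

text \<open>If 1 = 0 on \<open>N\<close>, then every map into or out of \<open>N\<close> equals its
  composite with 1, hence is zero. The criterion is equational, so additive functors preserve
  it.\<close>

lemma is_zero_object_if_Id_Zero:
  assumes "N \<in> Obj C" "Id C N = Zero C N N"
  shows "is_zero_object C N"
proof -
  have "f = Zero C (src f) N" if "arr f" "tgt f = N" for f
    using that assms Id_Comp_arr[of f N] by simp
  moreover have "f = Zero C N (tgt f)" if "arr f" "src f = N" for f
    using that assms Comp_Id_arr[of f N] by simp
  ultimately have "\<exists>!f. f \<in> Hom C A N" "\<exists>!f. f \<in> Hom C N A" if "A \<in> Obj C" for A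
    using that assms(1) arr_Zero[of A N] arr_Zero[of N A] by (simp, metis)+
  then show ?thesis unfolding is_zero_object_def using assms(1) by blast
qed

section \<open>Biproducts\<close>

text \<open>The facts about a further map \<open>f\<close> are the reassociated forms of the four
  matrix identities. The decomposition of the identity comes last, so that the first 21 facts can
  serve as simp rules without it.\<close>

lemma is_biproductD:
  assumes "is_biproduct C A B (Biproduct P i j p q)" "A \<in> Obj C" "B \<in> Obj C"
  shows "P \<in> Obj C"
    and "arr i" "src i = A" "tgt i = P" "arr j" "src j = B" "tgt j = P"
    and "arr p" "src p = P" "tgt p = A" "arr q" "src q = P" "tgt q = B"
    and "p \<cdot> i = Id C A" "q \<cdot> j = Id C B" "p \<cdot> j = Zero C B A" "q \<cdot> i = Zero C A B"
    and "\<lbrakk>arr f; tgt f = A\<rbrakk> \<Longrightarrow> p \<cdot> (i \<cdot> f) = f"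
    and "\<lbrakk>arr f; tgt f = B\<rbrakk> \<Longrightarrow> q \<cdot> (j \<cdot> f) = f"
    and "\<lbrakk>arr f; tgt f = B\<rbrakk> \<Longrightarrow> p \<cdot> (j \<cdot> f) = Zero C (src f) A"
    and "\<lbrakk>arr f; tgt f = A\<rbrakk> \<Longrightarrow> q \<cdot> (i \<cdot> f) = Zero C (src f) B"
    and "(i \<cdot> p) \<boxplus> (j \<cdot> q) = Id C P"
proof -
  show *: "P \<in> Obj C"
    "arr i" "src i = A" "tgt i = P" "arr j" "src j = B" "tgt j = P"
    "arr p" "src p = P" "tgt p = A" "arr q" "src q = P" "tgt q = B"
    "p \<cdot> i = Id C A" "q \<cdot> j = Id C B" "p \<cdot> j = Zero C B A" "q \<cdot> i = Zero C A B"
    "(i \<cdot> p) \<boxplus> (j \<cdot> q) = Id C P"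
    using assms by auto
  show "\<lbrakk>arr f; tgt f = A\<rbrakk> \<Longrightarrow> p \<cdot> (i \<cdot> f) = f"
    and "\<lbrakk>arr f; tgt f = B\<rbrakk> \<Longrightarrow> q \<cdot> (j \<cdot> f) = f"
    and "\<lbrakk>arr f; tgt f = B\<rbrakk> \<Longrightarrow> p \<cdot> (j \<cdot> f) = Zero C (src f) A"
    and "\<lbrakk>arr f; tgt f = A\<rbrakk> \<Longrightarrow> q \<cdot> (i \<cdot> f) = Zero C (src f) B"
    using Comp_reassoc[OF *(14)] Comp_reassoc[OF *(15)] Comp_reassoc[OF *(16)]
      Comp_reassoc[OF *(17)] * assms(2,3) by simp_all
qed

text \<open>Composing with the decomposition of the identity writes a map out of a biproduct in
  terms of its two columns. Matrix identities below are checked column by column in this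
  way.\<close>

lemma biproduct_ext:
  assumes P: "is_biproduct C A B (Biproduct P i j p q)" "A \<in> Obj C" "B \<in> Obj C"
    and "arr f" "arr g" "src f = P" "src g = P" "tgt f = D" "tgt g = D"
    and "f \<cdot> i = g \<cdot> i" "f \<cdot> j = g \<cdot> j"
  shows "f = g"
proof -
  note [simp] = is_biproductD[OF P]
  have "h = ((h \<cdot> i) \<cdot> p) \<boxplus> ((h \<cdot> j) \<cdot> q)" if "arr h" "src h = P" for h
  proof -
    \<comment> \<open>Distributivity is switched off here so that the sum collapses to the identity;
      in the next step the collapse is switched off so that distributivity applies.\<close>
    have "h = h \<cdot> ((i \<cdot> p) \<boxplus> (j \<cdot> q))" using that by (simp del: Comp_Add_arr)
    also have "\<dots> = ((h \<cdot> i) \<cdot> p) \<boxplus> ((h \<cdot> j) \<cdot> q)"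
      using that by (simp del: is_biproductD(22)[OF P])
    finally show ?thesis .
  qed
  from this[of f] this[of g] assms(4-) show ?thesis by metis
qed

lemma biprod_is_biproduct:
  assumes "A \<in> Obj C" "B \<in> Obj C"
  shows "is_biproduct C A B (Biproduct (bobj (biprod C A B)) (bin1 (biprod C A B))
    (bin2 (biprod C A B)) (bpr1 (biprod C A B)) (bpr2 (biprod C A B)))"
  using someI_ex[OF ex_biproduct[OF assms]] unfolding biprod_def by simp

text \<open>The automorphism with matrix rows (1, k) and (0, 1) is applied to the biproduct. Moving
  the second injection by \<open>i \<cdot> k\<close> forces the correction
  \<open>- k \<cdot> q\<close> in the first projection, and the two terms
  \<open>i \<cdot> k \<cdot> q\<close> cancel.\<close>

lemma biproduct_shear:
  assumes P: "is_biproduct C A B (Biproduct P i j p q)" "A \<in> Obj C" "B \<in> Obj C"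
    and k: "arr k" "src k = B" "tgt k = A"
  shows "is_biproduct C A B (Biproduct P i (j \<boxplus> (i \<cdot> k)) (p \<boxplus> Neg C P A (k \<cdot> q)) q)"
proof -
  note P' = is_biproductD[OF P]
  note [simp] = P'(1-21) assms(2,3) k
  have "(i \<cdot> (p \<boxplus> Neg C P A (k \<cdot> q))) \<boxplus> ((j \<boxplus> (i \<cdot> k)) \<cdot> q) = (i \<cdot> p) \<boxplus> (j \<cdot> q)"
    by (simp add: Add_left_commute Add_commute)
  then show ?thesis by (simp add: P'(22))
qed

text \<open>Such a \<open>t\<close> differs from the identity by \<open>e\<close> with \<open>e \<cdot> v = 0\<close> and \<open>w \<cdot> e = 0\<close>, so \<open>e\<close> factors
  through \<open>w\<close> and hence squares to zero.\<close>

lemma unipotent_inverse: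
  assumes v: "arr v" "tgt v = Z" and w: "arr w" "src w = Z" "tgt w = W"
    and wc: "\<And>e. \<lbrakk>arr e; src e = Z; tgt e = Z; e \<cdot> v = Zero C (src v) Z\<rbrakk>
      \<Longrightarrow> \<exists>r. arr r \<and> src r = W \<and> tgt r = Z \<and> e = r \<cdot> w"
    and t: "arr t" "src t = Z" "tgt t = Z" "t \<cdot> v = v" "w \<cdot> t = w"
  obtains s where "arr s" "src s = Z" "tgt s = Z" "s \<cdot> t = Id C Z" "t \<cdot> s = Id C Z"
proof -
  note [simp] = v w t(1-3)
  have [simp]: "Z \<in> Obj C" "W \<in> Obj C" using arr_objs v w by metis+
  define e where "e = t \<boxplus> Neg C Z Z (Id C Z)"
  have [simp]: "arr e" "src e = Z" "tgt e = Z" unfolding e_def by simp_all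
  have "e \<cdot> v = Zero C (src v) Z" unfolding e_def by (simp add: t)
  then obtain r where [simp]: "arr r" "src r = W" "tgt r = Z" and er: "e = r \<cdot> w"
    using wc[of e] by auto
  have "w \<cdot> e = Zero C Z W" unfolding e_def by (simp add: t)
  then have ee: "e \<cdot> e = Zero C Z Z" 
    using Comp_assoc_arr[of e w r] by (simp add: er[symmetric])
  have te: "t = Id C Z \<boxplus> e" unfolding e_def by (simp add: Add_left_commute)
  \<comment> \<open>As e squares to zero, 1 - e is inverse to t = 1 + e.\<close>
  show ?thesis
  proof (rule that[of "Id C Z \<boxplus> Neg C Z Z e"])
    show "(Id C Z \<boxplus> Neg C Z Z e) \<cdot> t = Id C Z" "t \<cdot> (Id C Z \<boxplus> Neg C Z Z e) = Id C Z"
      unfolding te by (simp_all add: ee)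
  qed simp_all
qed

end

section \<open>Exact triangles\<close>

context triangulated_category
begin

section \<open>The suspension as an additive self-equivalence\<close>

lemma Susp_endofunctor: "is_endofunctor T (Susp T) (SuspMap T)"
  by (rule self_equivalence_endofunctor[OF Susp_equivalence])

lemmas Susp_simps [simp] = endofunctorD[OF Susp_endofunctor]
lemmas Susp_faithful = self_equivalence_faithful[OF Susp_equivalence]
lemmas Susp_full = self_equivalence_full[OF Susp_equivalence]

lemma SuspMap_Add [simp]:
  "\<lbrakk>arr f; arr g; src f = src g; tgt f = tgt g\<rbrakk>
    \<Longrightarrow> SuspMap T (f \<boxplus> g) = SuspMap T f \<boxplus> SuspMap T g"
  using Susp_additive[of "src f" "tgt f" f g] by simp

lemma SuspMap_Zero [simp]:
  assumes "A \<in> Obj T" "B \<in> Obj T"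
  shows "SuspMap T (Zero T A B) = Zero T (Susp T A) (Susp T B)"
proof -
  have "SuspMap T (Zero T A B \<boxplus> Zero T A B) = SuspMap T (Zero T A B) \<boxplus> SuspMap T (Zero T A B)"
    by (rule SuspMap_Add) (use assms in simp_all)
  then show ?thesis using assms by (intro Add_idem_Zero) simp_all
qed

lemma SuspMap_Neg [simp]:
  assumes "arr f" "src f = A" "tgt f = B"
  shows "SuspMap T (Neg T A B f) = Neg T (Susp T A) (Susp T B) (SuspMap T f)"
proof (rule Neg_unique)
  have [simp]: "A \<in> Obj T" "B \<in> Obj T" using assms arr_objs by metis+
  have "SuspMap T (Neg T A B f \<boxplus> f) = SuspMap T (Neg T A B f) \<boxplus> SuspMap T f"
    by (rule SuspMap_Add) (use assms in simp_all)
  then show "SuspMap T (Neg T A B f) \<boxplus> SuspMap T f = Zero T (Susp T A) (Susp T B)"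
    using assms by simp
qed (use assms in simp_all)

lemma Susp_zero_object:
  assumes "is_zero_object T N"
  shows "is_zero_object T (Susp T N)"
proof (rule is_zero_object_if_Id_Zero)
  have N: "N \<in> Obj T" using assms by (rule zero_object_Obj)
  then show "Susp T N \<in> Obj T" by simp
  have "Id T N = Zero T N N" using arr_to_zero_object[OF assms, of "Id T N"] N by simp
  then show "Id T (Susp T N) = Zero T (Susp T N) (Susp T N)"
    using Susp_simps(2)[OF N] N by simp
qed

section \<open>Fill-ins, vanishing composites, weak kernels and weak cokernels\<close>

lemma exactD:
  assumes "Triangle X Y Z u v w \<in> Exact T"
  shows "X \<in> Obj T" "Y \<in> Obj T" "Z \<in> Obj T"
    and "arr u" "src u = X" "tgt u = Y"
    and "arr v" "src v = Y" "tgt v = Z"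
    and "arr w" "src w = Z" "tgt w = Susp T X"
  using Exact_candidate[OF assms] by auto

lemma rotate:
  assumes "Triangle X Y Z u v w \<in> Exact T"
  shows "Triangle Y Z (Susp T X) v w (Neg T (Susp T X) (Susp T Y) (SuspMap T u)) \<in> Exact T"
  using TR2[OF Exact_candidate[OF assms]] assms by simp

lemma fill_in_third:
  assumes t: "Triangle X Y Z u v w \<in> Exact T" and t': "Triangle X' Y' Z' u' v' w' \<in> Exact T"
    and "arr f" "src f = X" "tgt f = X'" "arr g" "src g = Y" "tgt g = Y'" "g \<cdot> u = u' \<cdot> f"
  obtains h where "arr h" "src h = Z" "tgt h = Z'" "h \<cdot> v = v' \<cdot> g" "SuspMap T f \<cdot> w = w' \<cdot> h"
  using TR3[OF t t', of f g] assms exactD[OF t] exactD[OF t'] by auto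

text \<open>TR3 on the rotated triangles yields a map between the suspensions of the first objects.
  It is some \<Sigma>f by fullness, and the square it fits into desuspends by faithfulness; the
  signs of the two rotations cancel.\<close>

lemma fill_in_first:
  assumes t: "Triangle X Y Z u v w \<in> Exact T" and t': "Triangle X' Y' Z' u' v' w' \<in> Exact T"
    and g: "arr g" "src g = Y" "tgt g = Y'" and h: "arr h" "src h = Z" "tgt h = Z'"
    and hv: "h \<cdot> v = v' \<cdot> g"
  obtains f where "arr f" "src f = X" "tgt f = X'" "g \<cdot> u = u' \<cdot> f" "SuspMap T f \<cdot> w = w' \<cdot> h"
proof -
  note [simp] = exactD[OF t] exactD[OF t'] g h
  obtain k where [simp]: "arr k" "src k = Susp T X" "tgt k = Susp T X'" and k: "k \<cdot> w = w' \<cdot> h"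
    and kk: "SuspMap T g \<cdot> Neg T (Susp T X) (Susp T Y) (SuspMap T u)
      = Neg T (Susp T X') (Susp T Y') (SuspMap T u') \<cdot> k"
    using fill_in_third[OF rotate[OF t] rotate[OF t'] g h hv] by metis
  obtain f where [simp]: "arr f" "src f = X" "tgt f = X'" and f: "SuspMap T f = k"
    using Susp_full[of X X' k] by auto
  have "SuspMap T g \<cdot> SuspMap T u = SuspMap T u' \<cdot> k"
    by (rule Neg_inject[of "Susp T X" "Susp T Y'"]) (use kk in simp_all)
  then have "g \<cdot> u = u' \<cdot> f" by - (rule Susp_faithful, simp_all add: f)
  then show ?thesis using that[of f] k f by simp
qed

text \<open>The pair (1, u) maps the trivial triangle on \<open>X\<close> to the given one. Its
  fill-in starts at a zero object, so v u factors through zero.\<close>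

lemma exact_Comp_Zero_first:
  assumes t: "Triangle X Y Z u v w \<in> Exact T"
  shows "v \<cdot> u = Zero T X Z"
proof -
  note [simp] = exactD[OF t]
  obtain N where N: "is_zero_object T N" using ex_zero_object by blast
  note [simp] = zero_object_Obj[OF N]
  obtain h where [simp]: "arr h" "src h = N" "tgt h = Z" and h: "h \<cdot> Zero T X N = v \<cdot> u"
    using fill_in_third[OF TR1_Id[OF exactD(1)[OF t] N] t, of "Id T X" u] by auto
  then show ?thesis using Comp_Zero[of X h N] by simp
qed

lemma exact_Comp_Zero:
  assumes t: "Triangle X Y Z u v w \<in> Exact T"
  shows "v \<cdot> u = Zero T X Z" "w \<cdot> v = Zero T Y (Susp T X)"
    and "SuspMap T u \<cdot> w = Zero T Z (Susp T Y)"
proof -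
  note [simp] = exactD[OF t]
  show "v \<cdot> u = Zero T X Z" by (rule exact_Comp_Zero_first[OF t])
  show "w \<cdot> v = Zero T Y (Susp T X)" by (rule exact_Comp_Zero_first[OF rotate[OF t]])
  \<comment> \<open>Two rotations make w and -\<Sigma>u consecutive; the sign does not affect
    vanishing.\<close>
  show "SuspMap T u \<cdot> w = Zero T Z (Susp T Y)"
    using exact_Comp_Zero_first[OF rotate[OF rotate[OF t]]] by (simp add: Neg_eq_Zero_iff)
qed

text \<open>The pair (e, 0) on second and third objects commutes with the trivial triangle on
  \<open>S\<close> as source; the fill-in on first objects is the factorization.\<close>

lemma exact_weak_kernel:
  assumes t: "Triangle X Y Z u v w \<in> Exact T"
    and e: "arr e" "src e = S" "tgt e = Y" "v \<cdot> e = Zero T S Z"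
  obtains s where "arr s" "src s = S" "tgt s = X" "e = u \<cdot> s"
proof -
  note [simp] = exactD[OF t] e
  have [simp]: "S \<in> Obj T" using arr_objs e by metis
  obtain N where N: "is_zero_object T N" using ex_zero_object by blast
  note [simp] = zero_object_Obj[OF N]
  have "Triangle S S N (Id T S) (Zero T S N) (Zero T N (Susp T S)) \<in> Exact T"
    by (rule TR1_Id[OF _ N]) simp
  then obtain s where "arr s" "src s = S" "tgt s = X" "e \<cdot> Id T S = u \<cdot> s"
    using fill_in_first[OF _ t, of S S N "Id T S" "Zero T S N" "Zero T N (Susp T S)" e "Zero T N Z"]
    by auto
  then show ?thesis using that by simp
qed

text \<open>The pair (0, e) maps the rotated triangle to N -> S -> S with identity second map; the
  fill-in on third objects is the factorization.\<close>

lemma exact_weak_cokernel: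
  assumes t: "Triangle X Y Z u v w \<in> Exact T"
    and e: "arr e" "src e = Z" "tgt e = S" "e \<cdot> v = Zero T Y S"
  obtains r where "arr r" "src r = Susp T X" "tgt r = S" "e = r \<cdot> w"
proof -
  note [simp] = exactD[OF t] e
  have [simp]: "S \<in> Obj T" using arr_objs e by metis
  obtain N where N: "is_zero_object T N" using ex_zero_object by blast
  note [simp] = zero_object_Obj[OF N]
  have c: "is_candidate T (Triangle N S S (Zero T N S) (Id T S) (Zero T S (Susp T N)))" by simp
  have "Triangle S S (Susp T N) (Id T S) (Zero T S (Susp T N)) (Zero T (Susp T N) (Susp T S))
      \<in> Exact T"
    by (rule TR1_Id[OF _ Susp_zero_object[OF N]]) simp
  \<comment> \<open>TR2 is read backwards: \<Sigma>N is again a zero object, so the rotation of this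
    triangle is a trivial one.\<close>
  then have "Triangle N S S (Zero T N S) (Id T S) (Zero T S (Susp T N)) \<in> Exact T"
    using TR2[OF c] by simp
  then obtain r where "arr r" "src r = Susp T X" "tgt r = S" "r \<cdot> w = Id T S \<cdot> e"
    using fill_in_third[OF rotate[OF t], of N S S "Zero T N S" "Id T S" "Zero T S (Susp T N)"
      "Zero T Y N" e] by auto
  then show ?thesis using that by simp
qed

text \<open>The isomorphism (1, -1, 1) from the rotated triangle flips the signs of v and w. The
  result is the lower diagonal of a mapping cone.\<close>

lemma exact_neg_rotate:
  assumes t: "Triangle X Y Z u v w \<in> Exact T"
  shows "Triangle Y Z (Susp T X) (Neg T Y Z v) (Neg T Z (Susp T X) w)
    (Neg T (Susp T X) (Susp T Y) (SuspMap T u)) \<in> Exact T"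
proof -
  note [simp] = exactD[OF t]
  have "is_iso T Z Z (Neg T Z Z (Id T Z))"
    by (rule is_iso_inverse_arrs[of _ _ _ "Neg T Z Z (Id T Z)" "Neg T Z Z (Id T Z)"]) simp_all
  then show ?thesis
    by - (rule TR1_iso[OF rotate[OF t], of _ "Id T Y" "Neg T Z Z (Id T Z)" "Id T (Susp T X)"],
      simp_all add: is_iso_Id)
qed

text \<open>A triangle \<open>M\<close> that decomposes as a direct sum of two exact ones is compared with an exact
  triangle \<open>W\<close> on its first map, in both directions. Both composites of the comparison maps on third
  objects are unipotent, so no long exact sequences are needed.\<close>

lemma exact_direct_sum:
  assumes a: "Triangle A1 A2 A3 a1 a2 a3 \<in> Exact T"
    and b: "Triangle B1 B2 B3 b1 b2 b3 \<in> Exact T"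
    and P1: "is_biproduct T A1 B1 (Biproduct P1 i1 j1 p1 q1)"
    and P2: "is_biproduct T A2 B2 (Biproduct P2 i2 j2 p2 q2)"
    and P3: "is_biproduct T A3 B3 (Biproduct P3 i3 j3 p3 q3)"
    and m: "is_candidate T (Triangle P1 P2 P3 m1 m2 m3)"
    and i: "is_triangle_map T (Triangle A1 A2 A3 a1 a2 a3) (Triangle P1 P2 P3 m1 m2 m3) i1 i2 i3"
    and j: "is_triangle_map T (Triangle B1 B2 B3 b1 b2 b3) (Triangle P1 P2 P3 m1 m2 m3) j1 j2 j3"
  shows "Triangle P1 P2 P3 m1 m2 m3 \<in> Exact T"
proof -
  note [simp] = exactD[OF a] exactD[OF b]
  note D1 = is_biproductD[OF P1 exactD(1)[OF a] exactD(1)[OF b]]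
  note D2 = is_biproductD[OF P2 exactD(2)[OF a] exactD(2)[OF b]]
  note D3 = is_biproductD[OF P3 exactD(3)[OF a] exactD(3)[OF b]]
  note [simp] = D1(1-21) D2(1-21) D3(1-21)
  note ext1 = biproduct_ext[OF P1 exactD(1)[OF a] exactD(1)[OF b]]
  note ext2 = biproduct_ext[OF P2 exactD(2)[OF a] exactD(2)[OF b]]
  note ext3 = biproduct_ext[OF P3 exactD(3)[OF a] exactD(3)[OF b]]
  have [simp]: "arr m1" "src m1 = P1" "tgt m1 = P2" "arr m2" "src m2 = P2" "tgt m2 = P3"
    "arr m3" "src m3 = P3" "tgt m3 = Susp T P1"
    using m by auto
  have mi: "m1 \<cdot> i1 = i2 \<cdot> a1" "m2 \<cdot> i2 = i3 \<cdot> a2" "m3 \<cdot> i3 = SuspMap T i1 \<cdot> a3"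
    using i by auto
  have mj: "m1 \<cdot> j1 = j2 \<cdot> b1" "m2 \<cdot> j2 = j3 \<cdot> b2" "m3 \<cdot> j3 = SuspMap T j1 \<cdot> b3"
    using j by auto
  \<comment> \<open>As the injections commute with the structure maps, \<open>M\<close> is diagonal;
    hence the projections commute with them as well.\<close>
  have pm1: "p2 \<cdot> m1 = a1 \<cdot> p1" by (rule ext1) (simp_all add: mi mj)
  have qm1: "q2 \<cdot> m1 = b1 \<cdot> q1" by (rule ext1) (simp_all add: mi mj)
  have pm2: "p3 \<cdot> m2 = a2 \<cdot> p2" by (rule ext2) (simp_all add: mi mj)
  have qm2: "q3 \<cdot> m2 = b2 \<cdot> q2" by (rule ext2) (simp_all add: mi mj)
  \<comment> \<open>The biproduct identities survive under \<Sigma>, so \<open>Susp T P1\<close> is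
    a biproduct of the suspended first objects.\<close>
  have S: "SuspMap T p1 \<cdot> SuspMap T i1 = Id T (Susp T A1)"
    "SuspMap T q1 \<cdot> SuspMap T j1 = Id T (Susp T B1)"
    "SuspMap T p1 \<cdot> SuspMap T j1 = Zero T (Susp T B1) (Susp T A1)"
    "SuspMap T q1 \<cdot> SuspMap T i1 = Zero T (Susp T A1) (Susp T B1)"
    using Susp_simps(6)[of i1 p1] Susp_simps(6)[of j1 q1] Susp_simps(6)[of j1 p1]
      Susp_simps(6)[of i1 q1] by simp_all
  note S' = S[THEN Comp_reassoc]
  have pm3: "SuspMap T p1 \<cdot> m3 = a3 \<cdot> p3" by (rule ext3) (simp_all add: mi mj S')
  have qm3: "SuspMap T q1 \<cdot> m3 = b3 \<cdot> q3" by (rule ext3) (simp_all add: mi mj S')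
  have SId: "(SuspMap T i1 \<cdot> SuspMap T p1) \<boxplus> (SuspMap T j1 \<cdot> SuspMap T q1) = Id T (Susp T P1)"
    using arg_cong[OF D1(22), of "SuspMap T"] by simp
  obtain W p q where w: "Triangle P1 P2 W m1 p q \<in> Exact T"
    using TR1_cone[of P1 P2 m1] by auto
  note [simp] = exactD(3,7-12)[OF w]
  obtain h where [simp]: "arr h" "src h = A3" "tgt h = W"
    and h: "h \<cdot> a2 = p \<cdot> i2" "SuspMap T i1 \<cdot> a3 = q \<cdot> h"
    by (rule fill_in_third[OF a w, of i1 i2]) (simp_all add: mi)
  obtain k where [simp]: "arr k" "src k = B3" "tgt k = W"
    and k: "k \<cdot> b2 = p \<cdot> j2" "SuspMap T j1 \<cdot> b3 = q \<cdot> k"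
    by (rule fill_in_third[OF b w, of j1 j2]) (simp_all add: mj)
  obtain c where [simp]: "arr c" "src c = W" "tgt c = A3"
    and c: "c \<cdot> p = a2 \<cdot> p2" "SuspMap T p1 \<cdot> q = a3 \<cdot> c"
    by (rule fill_in_third[OF w a, of p1 p2]) (simp_all add: pm1)
  obtain d where [simp]: "arr d" "src d = W" "tgt d = B3"
    and d: "d \<cdot> p = b2 \<cdot> q2" "SuspMap T q1 \<cdot> q = b3 \<cdot> d"
    by (rule fill_in_third[OF w b, of q1 q2]) (simp_all add: qm1)
  \<comment> \<open>The four fill-ins assemble into comparison maps between \<open>P3\<close> and
    \<open>W\<close> in both directions, compatible with identities on \<open>P1\<close> and
    \<open>P2\<close>.\<close>
  define \<phi> where "\<phi> = (h \<cdot> p3) \<boxplus> (k \<cdot> q3)"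
  define \<psi> where "\<psi> = (i3 \<cdot> c) \<boxplus> (j3 \<cdot> d)"
  have [simp]: "arr \<phi>" "src \<phi> = P3" "tgt \<phi> = W" "arr \<psi>" "src \<psi> = W" "tgt \<psi> = P3"
    unfolding \<phi>_def \<psi>_def by simp_all
  have \<phi>m: "\<phi> \<cdot> m2 = p"
    by (rule ext2) (simp_all add: \<phi>_def mi mj h(1) k(1))
  have q\<phi>: "q \<cdot> \<phi> = m3"
    by (rule ext3) (simp_all add: \<phi>_def mi mj h(2) k(2))
  have \<psi>p: "\<psi> \<cdot> p = m2"
    by (rule ext2) (simp_all add: \<psi>_def mi mj c(1) d(1))
  \<comment> \<open>\<open>W\<close> is not given as a biproduct, so this identity is not checked on
    columns; instead q is split by the decomposition of the identity of
    \<open>Susp T P1\<close>.\<close>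
  have "m3 \<cdot> \<psi> = (SuspMap T i1 \<cdot> (a3 \<cdot> c)) \<boxplus> (SuspMap T j1 \<cdot> (b3 \<cdot> d))"
    by (simp add: \<psi>_def Comp_reassoc[OF mi(3)] Comp_reassoc[OF mj(3)])
  also have "\<dots> = ((SuspMap T i1 \<cdot> SuspMap T p1) \<boxplus> (SuspMap T j1 \<cdot> SuspMap T q1)) \<cdot> q"
    by (simp add: c(2) d(2))
  also have "\<dots> = q" unfolding SId by simp
  finally have m\<psi>: "m3 \<cdot> \<psi> = q" .
  obtain s where s: "arr s" "src s = W" "tgt s = W" "s \<cdot> (\<phi> \<cdot> \<psi>) = Id T W"
  proof (rule unipotent_inverse[of p W q "Susp T P1" "\<phi> \<cdot> \<psi>"])
    show "\<exists>r. arr r \<and> src r = Susp T P1 \<and> tgt r = W \<and> e = r \<cdot> q"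
      if "arr e" "src e = W" "tgt e = W" "e \<cdot> p = Zero T (src p) W" for e
      using exact_weak_cokernel[OF w, of e W] that by (metis exactD(8)[OF w])
  qed (simp_all add: \<psi>p \<phi>m q\<phi> m\<psi> Comp_reassoc[OF q\<phi>])
  obtain s' where s': "arr s'" "src s' = P3" "tgt s' = P3" "(\<psi> \<cdot> \<phi>) \<cdot> s' = Id T P3"
  proof (rule unipotent_inverse[of m2 P3 m3 "Susp T P1" "\<psi> \<cdot> \<phi>"])
    \<comment> \<open>Exactness of \<open>M\<close> is still to be shown, so the factorization
      through \<open>m3\<close> is built from the weak cokernel properties of the two
      summands.\<close>
    fix e assume e: "arr e" "src e = P3" "tgt e = P3" and em: "e \<cdot> m2 = Zero T (src m2) P3"
    note [simp] = e
    have "(e \<cdot> i3) \<cdot> a2 = Zero T A2 P3"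
      using Comp_reassoc[OF em, of i2] by (simp add: mi)
    then obtain r where [simp]: "arr r" "src r = Susp T A1" "tgt r = P3" and r: "e \<cdot> i3 = r \<cdot> a3"
      using exact_weak_cokernel[OF a, of "e \<cdot> i3" P3] by auto
    have "(e \<cdot> j3) \<cdot> b2 = Zero T B2 P3"
      using Comp_reassoc[OF em, of j2] by (simp add: mj)
    then obtain r' where [simp]: "arr r'" "src r' = Susp T B1" "tgt r' = P3"
      and r': "e \<cdot> j3 = r' \<cdot> b3"
      using exact_weak_cokernel[OF b, of "e \<cdot> j3" P3] by auto
    have "e = ((r \<cdot> SuspMap T p1) \<boxplus> (r' \<cdot> SuspMap T q1)) \<cdot> m3"
      by (rule ext3) (simp_all add: mi mj S' r r')
    then show "\<exists>r. arr r \<and> src r = Susp T P1 \<and> tgt r = P3 \<and> e = r \<cdot> m3"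
      by (intro exI[of _ "(r \<cdot> SuspMap T p1) \<boxplus> (r' \<cdot> SuspMap T q1)"]) simp
  qed (simp_all add: \<psi>p \<phi>m q\<phi> m\<psi> Comp_reassoc[OF m\<psi>])
  \<comment> \<open>Inverting \<phi>\<psi> gives a left inverse of \<psi>, inverting \<psi>\<phi> a
    right inverse.\<close>
  have "is_iso T W P3 \<psi>"
    by (rule is_iso_inverse_arrs[of _ _ _ "s \<cdot> \<phi>" "\<phi> \<cdot> s'"]) (use s s' in simp_all)
  then show ?thesis
    by - (rule TR1_iso[OF w m, of "Id T P1" "Id T P2" \<psi>], simp_all add: is_iso_Id \<psi>p m\<psi>)
qed

section \<open>Mapping cones with zero third component\<close>

lemma biprod_cases:
  assumes "A \<in> Obj T" "B \<in> Obj T"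
  obtains P i j p q where "biprod T A B = Biproduct P i j p q"
    "is_biproduct T A B (Biproduct P i j p q)"
  using biprod_is_biproduct[OF assms] by (cases "biprod T A B") simp

text \<open>The cone is recorded by its columns. The first injections form a triangle map from the
  second triangle; the second columns are the three final equations. The identification of
  \<Sigma>X' \<oplus> \<Sigma>Y with \<Sigma>(X' \<oplus> Y) is absorbed, so only suspended
  injections remain.\<close>

lemma mapping_cone_zero:
  assumes t: "Triangle X Y Z u v w \<in> Exact T" and t': "Triangle X' Y' Z' u' v' w' \<in> Exact T"
    and f: "arr f" "src f = X" "tgt f = X'" and g: "arr g" "src g = Y" "tgt g = Y'"
  obtains P1 i1 j1 p1 q1 P2 i2 j2 p2 q2 P3 i3 j3 p3 q3 m1 m2 m3 where
    "is_biproduct T X' Y (Biproduct P1 i1 j1 p1 q1)"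
    "is_biproduct T Y' Z (Biproduct P2 i2 j2 p2 q2)"
    "is_biproduct T Z' (Susp T X) (Biproduct P3 i3 j3 p3 q3)"
    "mapping_cone T (Triangle X Y Z u v w) (Triangle X' Y' Z' u' v' w') f g (Zero T Z Z')
      = Triangle P1 P2 P3 m1 m2 m3"
    "is_candidate T (Triangle P1 P2 P3 m1 m2 m3)"
    "is_triangle_map T (Triangle X' Y' Z' u' v' w') (Triangle P1 P2 P3 m1 m2 m3) i1 i2 i3"
    "m1 \<cdot> j1 = (i2 \<cdot> g) \<boxplus> (j2 \<cdot> Neg T Y Z v)"
    "m2 \<cdot> j2 = j3 \<cdot> Neg T Z (Susp T X) w"
    "m3 \<cdot> j3 = (SuspMap T i1 \<cdot> SuspMap T f)
      \<boxplus> (SuspMap T j1 \<cdot> Neg T (Susp T X) (Susp T Y) (SuspMap T u))"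
proof -
  note [simp] = exactD[OF t] exactD[OF t'] f g
  obtain P1 i1 j1 p1 q1 where b1: "biprod T X' Y = Biproduct P1 i1 j1 p1 q1"
    and P1: "is_biproduct T X' Y (Biproduct P1 i1 j1 p1 q1)"
    by (rule biprod_cases[of X' Y]) simp_all
  obtain P2 i2 j2 p2 q2 where b2: "biprod T Y' Z = Biproduct P2 i2 j2 p2 q2"
    and P2: "is_biproduct T Y' Z (Biproduct P2 i2 j2 p2 q2)"
    by (rule biprod_cases[of Y' Z]) simp_all
  obtain P3 i3 j3 p3 q3 where b3: "biprod T Z' (Susp T X) = Biproduct P3 i3 j3 p3 q3"
    and P3: "is_biproduct T Z' (Susp T X) (Biproduct P3 i3 j3 p3 q3)"
    by (rule biprod_cases[of Z' "Susp T X"]) simp_all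
  obtain P4 i4 j4 p4 q4 where b4: "biprod T (Susp T X') (Susp T Y) = Biproduct P4 i4 j4 p4 q4"
    and P4: "is_biproduct T (Susp T X') (Susp T Y) (Biproduct P4 i4 j4 p4 q4)"
    by (rule biprod_cases[of "Susp T X'" "Susp T Y"]) simp_all
  note [simp] = is_biproductD(1-21)[OF P1 exactD(1)[OF t'] exactD(2)[OF t]]
  note [simp] = is_biproductD(1-21)[OF P2 exactD(2)[OF t'] exactD(3)[OF t]]
  note [simp] = is_biproductD(1-21)[OF P3 exactD(3)[OF t'] Susp_simps(1)[OF exactD(1)[OF t]]]
  note [simp] = is_biproductD(1-21)[OF P4 Susp_simps(1)[OF exactD(1)[OF t']]
      Susp_simps(1)[OF exactD(2)[OF t]]]
  define m1 where "m1 = (i2 \<cdot> ((u' \<cdot> p1) \<boxplus> (g \<cdot> q1)))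
    \<boxplus> (j2 \<cdot> ((Zero T X' Z \<cdot> p1) \<boxplus> (Neg T Y Z v \<cdot> q1)))"
  define m2 where "m2 = (i3 \<cdot> ((v' \<cdot> p2) \<boxplus> (Zero T Z Z' \<cdot> q2)))
    \<boxplus> (j3 \<cdot> ((Zero T Y' (Susp T X) \<cdot> p2) \<boxplus> (Neg T Z (Susp T X) w \<cdot> q2)))"
  define m3 where "m3 = ((SuspMap T i1 \<cdot> p4) \<boxplus> (SuspMap T j1 \<cdot> q4)) \<cdot>
    ((i4 \<cdot> ((w' \<cdot> p3) \<boxplus> (SuspMap T f \<cdot> q3)))
    \<boxplus> (j4 \<cdot> ((Zero T Z' (Susp T Y) \<cdot> p3) \<boxplus>
      (Neg T (Susp T X) (Susp T Y) (SuspMap T u) \<cdot> q3))))"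
  have [simp]: "arr m1" "src m1 = P1" "tgt m1 = P2" "arr m2" "src m2 = P2" "tgt m2 = P3"
    "arr m3" "src m3 = P3" "tgt m3 = Susp T P1"
    unfolding m1_def m2_def m3_def by simp_all
  show ?thesis
  proof (rule that[OF P1 P2 P3, of m1 m2 m3])
    show "mapping_cone T (Triangle X Y Z u v w) (Triangle X' Y' Z' u' v' w') f g (Zero T Z Z')
      = Triangle P1 P2 P3 m1 m2 m3"
      unfolding m1_def m2_def m3_def mapping_cone.simps Let_def b1 b2 b3 b4 matrix_map_def
        susp_biprod_map_def biproduct.sel ..
    show "is_candidate T (Triangle P1 P2 P3 m1 m2 m3)" by simp
    have "m1 \<cdot> i1 = i2 \<cdot> u'" "m2 \<cdot> i2 = i3 \<cdot> v'" "m3 \<cdot> i3 = SuspMap T i1 \<cdot> w'"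
      unfolding m1_def m2_def m3_def by simp_all
    then show "is_triangle_map T (Triangle X' Y' Z' u' v' w') (Triangle P1 P2 P3 m1 m2 m3) i1 i2 i3"
      by simp
    show "m1 \<cdot> j1 = (i2 \<cdot> g) \<boxplus> (j2 \<cdot> Neg T Y Z v)"
      "m2 \<cdot> j2 = j3 \<cdot> Neg T Z (Susp T X) w"
      "m3 \<cdot> j3 = (SuspMap T i1 \<cdot> SuspMap T f)
        \<boxplus> (SuspMap T j1 \<cdot> Neg T (Susp T X) (Susp T Y) (SuspMap T u))"
      unfolding m1_def m2_def m3_def by simp_all
  qed
qed

section \<open>The two implications\<close>

lemma good_zero_if_lift:
  assumes t: "Triangle X Y Z u v w \<in> Exact T" and t': "Triangle X' Y' Z' u' v' w' \<in> Exact T"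
    and f: "arr f" "src f = X" "tgt f = X'" and g: "arr g" "src g = Y" "tgt g = Y'"
    and k: "arr k" "src k = Y" "tgt k = X'" "k \<cdot> u = f" "u' \<cdot> k = g"
  shows "good_triangle_map T (Triangle X Y Z u v w) (Triangle X' Y' Z' u' v' w') f g (Zero T Z Z')"
proof -
  note [simp] = exactD[OF t] exactD[OF t'] f g k(1-3)
  \<comment> \<open>For a zero third component the last two squares say v' g = 0 and (\<Sigma>f) w =
    0. Both hold because g = u' k and f = k u, and consecutive maps of a triangle compose to
    zero.\<close>
  have v'g: "v' \<cdot> g = Zero T Y Z'"
    using Comp_reassoc[OF exact_Comp_Zero(1)[OF t'], of k] by (simp add: k)
  have Sku: "SuspMap T k \<cdot> SuspMap T u = SuspMap T f"
    using Susp_simps(6)[of u k] by (simp add: k)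
  then have Sfw: "SuspMap T f \<cdot> w = Zero T Z (Susp T X')"
    using Comp_assoc_arr[of w "SuspMap T u" "SuspMap T k"] exact_Comp_Zero(3)[OF t] by simp
  obtain P1 i1 j1 p1 q1 P2 i2 j2 p2 q2 P3 i3 j3 p3 q3 m1 m2 m3 where
    P1: "is_biproduct T X' Y (Biproduct P1 i1 j1 p1 q1)" and
    P2: "is_biproduct T Y' Z (Biproduct P2 i2 j2 p2 q2)" and
    P3: "is_biproduct T Z' (Susp T X) (Biproduct P3 i3 j3 p3 q3)" and
    M: "mapping_cone T (Triangle X Y Z u v w) (Triangle X' Y' Z' u' v' w') f g (Zero T Z Z')
      = Triangle P1 P2 P3 m1 m2 m3" and
    c: "is_candidate T (Triangle P1 P2 P3 m1 m2 m3)" and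
    i: "is_triangle_map T (Triangle X' Y' Z' u' v' w') (Triangle P1 P2 P3 m1 m2 m3) i1 i2 i3" and
    mj: "m1 \<cdot> j1 = (i2 \<cdot> g) \<boxplus> (j2 \<cdot> Neg T Y Z v)"
    "m2 \<cdot> j2 = j3 \<cdot> Neg T Z (Susp T X) w"
    "m3 \<cdot> j3 = (SuspMap T i1 \<cdot> SuspMap T f)
      \<boxplus> (SuspMap T j1 \<cdot> Neg T (Susp T X) (Susp T Y) (SuspMap T u))"
    by (rule mapping_cone_zero[OF t t' f g])
  note [simp] = is_biproductD(1-21)[OF P1 exactD(1)[OF t'] exactD(2)[OF t]]
  note [simp] = is_biproductD(1-21)[OF P2 exactD(2)[OF t'] exactD(3)[OF t]]
  note [simp] = is_biproductD(1-21)[OF P3 exactD(3)[OF t'] Susp_simps(1)[OF exactD(1)[OF t]]]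
  have [simp]: "arr m1" "src m1 = P1" "tgt m1 = P2" "arr m2" "src m2 = P2" "tgt m2 = P3"
    "arr m3" "src m3 = P3" "tgt m3 = Susp T P1"
    using c by auto
  have m1i: "m1 \<cdot> i1 = i2 \<cdot> u'" using i by simp
  \<comment> \<open>Shearing by -k clears the off-diagonal entries: g - u' k vanishes in the first
    map, and \<Sigma>f is absorbed as (\<Sigma>k)(\<Sigma>u) in the third.\<close>
  define j where "j = j1 \<boxplus> (i1 \<cdot> Neg T Y X' k)"
  have [simp]: "arr j" "src j = Y" "tgt j = P1" unfolding j_def by simp_all
  have "m1 \<cdot> j = j2 \<cdot> Neg T Y Z v"
    unfolding j_def by (simp add: mj Comp_reassoc[OF m1i] k Add_commute)
  moreover have "m3 \<cdot> j3 = SuspMap T j \<cdot> Neg T (Susp T X) (Susp T Y) (SuspMap T u)"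
    unfolding j_def by (simp add: mj Sku Add_commute)
  ultimately have "is_triangle_map T (Triangle Y Z (Susp T X) (Neg T Y Z v)
      (Neg T Z (Susp T X) w) (Neg T (Susp T X) (Susp T Y) (SuspMap T u)))
      (Triangle P1 P2 P3 m1 m2 m3) j j2 j3"
    using mj(2) by simp
  moreover have "is_biproduct T X' Y
      (Biproduct P1 i1 j (p1 \<boxplus> Neg T P1 X' (Neg T Y X' k \<cdot> q1)) q1)"
    unfolding j_def by (rule biproduct_shear[OF P1]) simp_all
  ultimately have "Triangle P1 P2 P3 m1 m2 m3 \<in> Exact T"
    using exact_direct_sum[OF t' exact_neg_rotate[OF t] _ P2 P3 c i] by blast
  then show ?thesis
    unfolding good_triangle_map_def M using k Comp_reassoc[OF k(5), of u]
    by (simp add: v'g Sfw)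
qed

lemma lift_if_good_zero:
  assumes t: "Triangle X Y Z u v w \<in> Exact T" and t': "Triangle X' Y' Z' u' v' w' \<in> Exact T"
    and f: "arr f" "src f = X" "tgt f = X'" and g: "arr g" "src g = Y" "tgt g = Y'"
    and good: "good_triangle_map T (Triangle X Y Z u v w) (Triangle X' Y' Z' u' v' w') f g
      (Zero T Z Z')"
  obtains k where "arr k" "src k = Y" "tgt k = X'" "k \<cdot> u = f" "u' \<cdot> k = g"
proof -
  note [simp] = exactD[OF t] exactD[OF t'] f g
  obtain P1 i1 j1 p1 q1 P2 i2 j2 p2 q2 P3 i3 j3 p3 q3 m1 m2 m3 where
    P1: "is_biproduct T X' Y (Biproduct P1 i1 j1 p1 q1)" and
    P2: "is_biproduct T Y' Z (Biproduct P2 i2 j2 p2 q2)" and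
    P3: "is_biproduct T Z' (Susp T X) (Biproduct P3 i3 j3 p3 q3)" and
    M: "mapping_cone T (Triangle X Y Z u v w) (Triangle X' Y' Z' u' v' w') f g (Zero T Z Z')
      = Triangle P1 P2 P3 m1 m2 m3" and
    c: "is_candidate T (Triangle P1 P2 P3 m1 m2 m3)" and
    i: "is_triangle_map T (Triangle X' Y' Z' u' v' w') (Triangle P1 P2 P3 m1 m2 m3) i1 i2 i3" and
    mj: "m1 \<cdot> j1 = (i2 \<cdot> g) \<boxplus> (j2 \<cdot> Neg T Y Z v)"
    "m2 \<cdot> j2 = j3 \<cdot> Neg T Z (Susp T X) w"
    "m3 \<cdot> j3 = (SuspMap T i1 \<cdot> SuspMap T f)
      \<boxplus> (SuspMap T j1 \<cdot> Neg T (Susp T X) (Susp T Y) (SuspMap T u))"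
    by (rule mapping_cone_zero[OF t t' f g])
  note D1 = is_biproductD[OF P1 exactD(1)[OF t'] exactD(2)[OF t]]
  note [simp] = D1(1-21)
  note [simp] = is_biproductD(1-21)[OF P2 exactD(2)[OF t'] exactD(3)[OF t]]
  note [simp] = is_biproductD(1-21)[OF P3 exactD(3)[OF t'] Susp_simps(1)[OF exactD(1)[OF t]]]
  have [simp]: "arr m1" "src m1 = P1" "tgt m1 = P2" "arr m2" "src m2 = P2" "tgt m2 = P3"
    "arr m3" "src m3 = P3" "tgt m3 = Susp T P1"
    using c by auto
  have m1i: "m1 \<cdot> i1 = i2 \<cdot> u'" using i by simp
  have M_exact: "Triangle P1 P2 P3 m1 m2 m3 \<in> Exact T"
    using good unfolding good_triangle_map_def M by simp
  obtain \<theta> where [simp]: "arr \<theta>" "src \<theta> = Y" "tgt \<theta> = P1"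
    and \<theta>: "j2 \<cdot> Neg T Y Z v = m1 \<cdot> \<theta>"
    "SuspMap T \<theta> \<cdot> Neg T (Susp T X) (Susp T Y) (SuspMap T u) = m3 \<cdot> j3"
    by (rule fill_in_first[OF exact_neg_rotate[OF t] M_exact, of j2 j3]) (simp_all add: mj)
  define b where "b = p1 \<cdot> \<theta>"
  define d where "d = q1 \<cdot> \<theta>"
  have [simp]: "arr b" "src b = Y" "tgt b = X'" "arr d" "src d = Y" "tgt d = Y"
    unfolding b_def d_def by simp_all
  have "\<theta> = ((i1 \<cdot> p1) \<boxplus> (j1 \<cdot> q1)) \<cdot> \<theta>" unfolding D1(22) by simp
  also have "\<dots> = (i1 \<cdot> b) \<boxplus> (j1 \<cdot> d)" unfolding b_def d_def by simp
  finally have m\<theta>: "j2 \<cdot> Neg T Y Z v = m1 \<cdot> ((i1 \<cdot> b) \<boxplus> (j1 \<cdot> d))" using \<theta> by simp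
  then have e1: "j2 \<cdot> Neg T Y Z v =
      (i2 \<cdot> (u' \<cdot> b)) \<boxplus> ((i2 \<cdot> (g \<cdot> d)) \<boxplus> (j2 \<cdot> (Neg T Y Z v \<cdot> d)))"
    by (simp add: Comp_reassoc[OF m1i] Comp_reassoc[OF mj(1)])
  \<comment> \<open>The two projections read off the two rows of the first square.\<close>
  from arg_cong[OF e1, of "Comp T p2"] have ub: "(u' \<cdot> b) \<boxplus> (g \<cdot> d) = Zero T Y Y'"
    by simp
  from arg_cong[OF e1, of "Comp T q2"] have "Neg T Y Z v = Neg T Y Z (v \<cdot> d)"
    by simp
  then have vd: "v = v \<cdot> d" by (rule Neg_inject) simp_all
  have S: "SuspMap T p1 \<cdot> SuspMap T i1 = Id T (Susp T X')"
    "SuspMap T q1 \<cdot> SuspMap T j1 = Id T (Susp T Y)"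
    "SuspMap T p1 \<cdot> SuspMap T j1 = Zero T (Susp T Y) (Susp T X')"
    "SuspMap T q1 \<cdot> SuspMap T i1 = Zero T (Susp T X') (Susp T Y)"
    using Susp_simps(6)[of i1 p1] Susp_simps(6)[of j1 q1] Susp_simps(6)[of j1 p1]
      Susp_simps(6)[of i1 q1] by simp_all
  note S' = S[THEN Comp_reassoc]
  have Sb: "SuspMap T p1 \<cdot> SuspMap T \<theta> = SuspMap T b"
    "SuspMap T q1 \<cdot> SuspMap T \<theta> = SuspMap T d"
    unfolding b_def d_def by simp_all
  note Sb' = Sb[THEN Comp_reassoc]
  \<comment> \<open>The two rows of the last square, read off by suspended projections, desuspend to
    f = -b u and d u = u.\<close>
  have "SuspMap T (Neg T X X' (b \<cdot> u)) = SuspMap T f"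
    using arg_cong[OF \<theta>(2)[unfolded mj], of "Comp T (SuspMap T p1)"] by (simp add: Sb' S')
  then have bu: "f = Neg T X X' (b \<cdot> u)"
    by - (rule Susp_faithful[symmetric], simp_all)
  have "Neg T (Susp T X) (Susp T Y) (SuspMap T (d \<cdot> u))
      = Neg T (Susp T X) (Susp T Y) (SuspMap T u)"
    using arg_cong[OF \<theta>(2)[unfolded mj], of "Comp T (SuspMap T q1)"] by (simp add: Sb' S')
  then have "SuspMap T (d \<cdot> u) = SuspMap T u" by (rule Neg_inject) simp_all
  then have du: "d \<cdot> u = u" by - (rule Susp_faithful, simp_all)
  define e where "e = d \<boxplus> Neg T Y Y (Id T Y)"
  have [simp]: "arr e" "src e = Y" "tgt e = Y" unfolding e_def by simp_all
  have "v \<cdot> e = Zero T Y Z" unfolding e_def by (simp add: vd[symmetric])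
  then obtain s where [simp]: "arr s" "src s = Y" "tgt s = X" and s: "e = u \<cdot> s"
    using exact_weak_kernel[OF t, of e Y] by auto
  have eu: "e \<cdot> u = Zero T X Y" unfolding e_def by (simp add: du)
  have ee: "e \<cdot> e = Zero T Y Y" using Comp_reassoc[OF eu, of s] by (simp add: s[symmetric])
  have de: "d = Id T Y \<boxplus> e" unfolding e_def by (simp add: Add_left_commute)
  have gd: "g \<cdot> d = Neg T Y Y' (u' \<cdot> b)"
    by (rule Neg_unique) (use ub in \<open>simp_all add: Add_commute\<close>)
  \<comment> \<open>This is -b (1 - e). Since e u = 0, composing with u leaves -b u = f.\<close>
  define k where "k = Neg T Y X' b \<boxplus> (b \<cdot> e)"
  have [simp]: "arr k" "src k = Y" "tgt k = X'" unfolding k_def by simp_all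
  have "k \<cdot> u = f" unfolding k_def bu by (simp add: eu)
  moreover have "u' \<cdot> k = g"
  proof -
    \<comment> \<open>Because -u' b = g d = g (1 + e), the composite becomes g (1 + e)(1 - e), and e
      squares to zero.\<close>
    have "u' \<cdot> k = Neg T Y Y' (u' \<cdot> b) \<cdot> (Id T Y \<boxplus> Neg T Y Y e)"
      unfolding k_def by simp
    also have "\<dots> = g \<cdot> ((Id T Y \<boxplus> e) \<cdot> (Id T Y \<boxplus> Neg T Y Y e))"
      unfolding gd[symmetric] de by simp
    also have "\<dots> = g" by (simp add: ee)
    finally show ?thesis .
  qed
  ultimately show ?thesis using that[of k] by simp
qed

end

theorem theorem4p3:
  fixes T :: "('o, 'm, 'x) triangulated_category_scheme" (structure)
  assumes "triangulated_category T"
    and "X \<in> Obj T" "Y \<in> Obj T" "X' \<in> Obj T" "Y' \<in> Obj T"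
    and "u \<in> Hom T X Y" "u' \<in> Hom T X' Y'" "f \<in> Hom T X X'" "g \<in> Hom T Y Y'"
    and "g \<cdot> u = u' \<cdot> f"
    and "Triangle X Y Z u v w \<in> Exact T"
    and "Triangle X' Y' Z' u' v' w' \<in> Exact T"
  shows "(\<exists>k\<in>Hom T Y X'. k \<cdot> u = f \<and> u' \<cdot> k = g) \<longleftrightarrow>
    good_triangle_map T (Triangle X Y Z u v w) (Triangle X' Y' Z' u' v' w') f g (Zero T Z Z')"
proof -
  interpret triangulated_category T by fact
  have f: "arr f" "src f = X" "tgt f = X'" and g: "arr g" "src g = Y" "tgt g = Y'"
    using assms(2-9) by simp_all
  have "\<exists>k\<in>Hom T Y X'. k \<cdot> u = f \<and> u' \<cdot> k = g"
    if good: "good_triangle_map T (Triangle X Y Z u v w) (Triangle X' Y' Z' u' v' w') f g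
      (Zero T Z Z')"
  proof (rule lift_if_good_zero[OF assms(11,12) f g good])
    fix k assume "arr k" "src k = Y" "tgt k = X'" "k \<cdot> u = f" "u' \<cdot> k = g"
    then show ?thesis using assms(3,4) by (intro bexI[of _ k]) simp_all
  qed
  moreover have "good_triangle_map T (Triangle X Y Z u v w) (Triangle X' Y' Z' u' v' w') f g
      (Zero T Z Z')" if "k \<in> Hom T Y X'" "k \<cdot> u = f" "u' \<cdot> k = g" for k
    using good_zero_if_lift[OF assms(11,12) f g, of k] that assms(3,4) by simp
  ultimately show ?thesis by blast
qed

end
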